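(* There exists a matroid $\mathsf{M}$ of rank $19$ on $21$ elements whose normalized inverse Kazhdan–Lusztig polynomial $\mathcal{B}(Q_{\mathsf{M}})(x)$ is not real-rooted.
   Context: For a loopless matroid $\mathsf{N}$, $\mu(\mathsf{N})$ is the Möbius value $\mu(\varnothing,E)$ of its lattice of flats $\mathcal{L}(\mathsf{N})$. The inverse Kazhdan–Lusztig polynomial $Q_{\mathsf{N}}(x)\in\mathbb{Z}[x]$ is the unique assignment to loopless matroids such that $Q_{\mathsf{N}}=1$ if $\operatorname{rk}\mathsf{N}=0$, $\deg Q_{\mathsf{N}}<\operatorname{rk}(\mathsf{N})/2$ if $\operatorname{rk}\mathsf{N}>0$, and $\sum_{F\in\mathcal{L}(\mathsf{N})}(-1)^{\operatorname{rk}\mathsf{N}-\operatorname{rk}F}\mu(\mathsf{N}/F)x^{\operatorname{rk}\mathsf{N}-\operatorname{rk}F}Q_{\mathsf{N}|_F}(x)$ is palindromic (invariant under $f(x)\mapsto x^{\operatorname{rk}\mathsf{N}}f(1/x)$). If $Q_{\mathsf{M}}(x)=q_0+q_1x+\cdots+q_sx^s$ with $s=\deg Q_{\mathsf{M}}$, its normalization is $\mathcal{B}(Q_{\mathsf{M}})(x)=\sum_{j=0}^s\binom{s}{j}q_jx^j$. A real polynomial is real-rooted if all its complex roots are real. *)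

theory Defs
  imports Complex_Main "HOL-Computational_Algebra.Polynomial"
begin

section \<open>Finite matroids\<close>

record 'a set_system =
  ground :: "'a set"
  indep :: "'a set set"

definition matroid :: "'a set_system \<Rightarrow> bool" where
  "matroid M \<longleftrightarrow>
     finite (ground M) \<and>
     indep M \<subseteq> Pow (ground M) \<and>
     {} \<in> indep M \<and>
     (\<forall>I\<in>indep M. \<forall>J. J \<subseteq> I \<longrightarrow> J \<in> indep M) \<and>
     (\<forall>I\<in>indep M. \<forall>J\<in>indep M. card I < card J \<longrightarrow> (\<exists>e\<in>J - I. insert e I \<in> indep M))"

definition loopless :: "'a set_system \<Rightarrow> bool" where
  "loopless M \<longleftrightarrow> (\<forall>e\<in>ground M. {e} \<in> indep M)"

definition rank_of :: "'a set_system \<Rightarrow> 'a set \<Rightarrow> nat" where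
  "rank_of M X = Max (card ` {I \<in> indep M. I \<subseteq> X})"

abbreviation rk :: "'a set_system \<Rightarrow> nat" where
  "rk M \<equiv> rank_of M (ground M)"

definition flats :: "'a set_system \<Rightarrow> 'a set set" where
  "flats M = {F. F \<subseteq> ground M \<and> (\<forall>e\<in>ground M - F. rank_of M F < rank_of M (insert e F))}"

definition basis_in :: "'a set_system \<Rightarrow> 'a set \<Rightarrow> 'a set \<Rightarrow> bool" where
  "basis_in M X B \<longleftrightarrow> B \<in> indep M \<and> B \<subseteq> X \<and> (\<forall>e\<in>X - B. insert e B \<notin> indep M)"

definition restriction :: "'a set_system \<Rightarrow> 'a set \<Rightarrow> 'a set_system" where
  "restriction M F = \<lparr>ground = F, indep = {I \<in> indep M. I \<subseteq> F}\<rparr>"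

definition contraction :: "'a set_system \<Rightarrow> 'a set \<Rightarrow> 'a set_system" where
  "contraction M F =
     \<lparr>ground = ground M - F,
      indep = {I. I \<subseteq> ground M - F \<and> (\<exists>B. basis_in M F B \<and> I \<union> B \<in> indep M)}\<rparr>"


section \<open>Moebius function\<close>

text \<open>The Moebius function of a finite set \<open>P\<close> with the order of its type, on sets the inclusion
  order. The condition \<open>finite P\<close> only serves termination.\<close>

function moebius :: "'a::order set \<Rightarrow> 'a \<Rightarrow> 'a \<Rightarrow> int" where
  "moebius P a b =
     (if a = b then 1
      else if finite P \<and> a < b then - (\<Sum>c\<in>{c \<in> P. a \<le> c \<and> c < b}. moebius P a c)
      else 0)"
  by pat_completeness auto
termination
proof (relation "measure (\<lambda>(P, a, b). card {c \<in> P. c < b})", goal_cases)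
  case 1
  show ?case by simp
next
  case (2 P a b c)
  then have "{d \<in> P. d < c} \<subset> {d \<in> P. d < b}" by (auto dest: less_trans)
  with 2 show ?case by (auto intro!: psubset_card_mono)
qed

declare moebius.simps [simp del]

definition moebius_value :: "'a set_system \<Rightarrow> int" where
  "moebius_value M = moebius (flats M) {} (ground M)"


section \<open>Inverse Kazhdan--Lusztig polynomials\<close>

text \<open>The identity \<open>f(x) = x ^ r * f(1/x)\<close> is required at all nonzero reals; lemma
  \<open>palindromic_iff_coeff\<close> below gives the coefficientwise form.\<close>

definition palindromic :: "nat \<Rightarrow> int poly \<Rightarrow> bool" where
  "palindromic r f \<longleftrightarrow>
     (\<forall>x::real. x \<noteq> 0 \<longrightarrow>
        poly (map_poly real_of_int f) x = x ^ r * poly (map_poly real_of_int f) (1 / x))"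

definition KL_sum :: "('a set_system \<Rightarrow> int poly) \<Rightarrow> 'a set_system \<Rightarrow> int poly" where
  "KL_sum Q M =
     (\<Sum>F\<in>flats M. smult ((- 1) ^ (rk M - rank_of M F) * moebius_value (contraction M F))
        (monom 1 (rk M - rank_of M F) * Q (restriction M F)))"

text \<open>Outside the loopless matroids an assignment gets the dummy value \<open>0\<close>, so that it is
  determined as a function on all of \<open>'a set_system\<close>.\<close>

definition inverse_KL_assignment :: "('a set_system \<Rightarrow> int poly) \<Rightarrow> bool" where
  "inverse_KL_assignment Q \<longleftrightarrow>
     (\<forall>M. matroid M \<and> loopless M \<longrightarrow>
        (rk M = 0 \<longrightarrow> Q M = 1) \<and>
        (rk M > 0 \<longrightarrow> real (degree (Q M)) < real (rk M) / 2) \<and>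
        palindromic (rk M) (KL_sum Q M)) \<and>
     (\<forall>M. \<not> (matroid M \<and> loopless M) \<longrightarrow> Q M = 0)"

definition inverse_KL :: "'a set_system \<Rightarrow> int poly" where
  "inverse_KL = (THE Q. inverse_KL_assignment Q)"

definition normalization :: "int poly \<Rightarrow> int poly" where
  "normalization p = (\<Sum>j\<le>degree p. monom (of_nat (degree p choose j) * coeff p j) j)"

definition real_rooted :: "real poly \<Rightarrow> bool" where
  "real_rooted p \<longleftrightarrow> (\<forall>z::complex. poly (map_poly complex_of_real p) z = 0 \<longrightarrow> z \<in> \<real>)"


section \<open>Existence and uniqueness of the inverse Kazhdan--Lusztig polynomials\<close>

lemma palindromic_iff_coeff:
  "palindromic r f \<longleftrightarrow> degree f \<le> r \<and> (\<forall>i\<le>r. coeff f i = coeff f (r - i))"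
proof -
  define g where "g = map_poly real_of_int f"
  define d where "d = degree g"
  have cg: "coeff g i = real_of_int (coeff f i)" for i
    unfolding g_def by (rule coeff_map_poly) simp
  have dg: "degree f = d"
    unfolding g_def d_def by (rule degree_map_poly[symmetric]) simp
  have "degree f \<le> r \<and> (\<forall>i\<le>r. coeff f i = coeff f (r - i))" if "palindromic r f"
  proof -
    define h where "h = monom 1 d * g - monom 1 r * reflect_poly g"
    have "poly h x = 0" if "x \<noteq> 0" for x
    proof -
      have "poly g x = x ^ r * poly g (inverse x)"
        using \<open>palindromic r f\<close> that
        unfolding palindromic_def g_def inverse_eq_divide by blast
      then show ?thesis
        unfolding h_def using poly_reflect_poly_nz[OF that, of g] by (simp add: poly_monom d_def)
    qed
    then have "UNIV - {0} \<subseteq> {x. poly h x = 0}" by blast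
    moreover have "infinite (UNIV - {0 :: real})"
      by (simp add: infinite_UNIV_char_0)
    ultimately have "h = 0"
      using poly_roots_finite finite_subset by blast
    then have "coeff (monom 1 d * g) i = coeff (monom 1 r * reflect_poly g) i" for i
      by (simp add: h_def)
    then have eq: "(if i < d then 0 else coeff g (i - d)) =
        (if i < r then 0 else if i - r > d then 0 else coeff g (d - (i - r)))" for i
      unfolding coeff_monom_mult coeff_reflect_poly d_def[symmetric] mult_1 .
    have "d \<le> r"
    proof (cases "g = 0")
      case False
      then have "coeff g d \<noteq> 0" by (simp add: d_def)
      with eq[of "d + d"] show ?thesis by (auto split: if_splits)
    qed (simp add: d_def)
    moreover have "coeff g i = coeff g (r - i)" if "i \<le> r" for i
    proof (cases "i + d < r")
      case True
      then have "coeff g (r - i) = 0" by (intro coeff_eq_0) (simp add: d_def)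
      with True eq[of "i + d"] show ?thesis by simp
    next
      case False
      then have "d - (i + d - r) = r - i" using that by simp
      with False that eq[of "i + d"] show ?thesis by simp
    qed
    ultimately show ?thesis
      unfolding dg cg of_int_eq_iff by blast
  qed
  moreover have "palindromic r f"
    if *: "degree f \<le> r \<and> (\<forall>i\<le>r. coeff f i = coeff f (r - i))"
  proof -
    have ev: "poly g x = (\<Sum>i\<le>r. coeff g i * x ^ i)" for x
      unfolding poly_altdef using * dg
      by (intro sum.mono_neutral_left) (auto simp: d_def coeff_eq_0)
    have "poly g x = x ^ r * poly g (1 / x)" if "x \<noteq> 0" for x
    proof -
      have "x ^ r * poly g (1 / x) = (\<Sum>i\<le>r. coeff g i * x ^ (r - i))"
        unfolding ev sum_distrib_left
      proof (rule sum.cong[OF refl])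
        fix i
        assume "i \<in> {..r}"
        then have "x ^ (r - i) = x ^ r / x ^ i" using that by (intro power_diff) auto
        then show "x ^ r * (coeff g i * (1 / x) ^ i) = coeff g i * x ^ (r - i)"
          by (simp add: power_one_over)
      qed
      also have "\<dots> = (\<Sum>i\<le>r. coeff g (r - i) * x ^ i)"
        by (rule sum.reindex_bij_witness[of _ "\<lambda>i. r - i" "\<lambda>i. r - i"]) auto
      also have "\<dots> = poly g x"
        unfolding ev cg
      proof (rule sum.cong[OF refl])
        fix i
        assume "i \<in> {..r}"
        then have "coeff f (r - i) = coeff f i" using * by (metis atMost_iff)
        then show "real_of_int (coeff f (r - i)) * x ^ i = real_of_int (coeff f i) * x ^ i"
          by (simp only:)
      qed
      finally show ?thesis by simp
    qed
    then show ?thesis unfolding palindromic_def g_def by blast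
  qed
  ultimately show ?thesis by blast
qed

lemma finite_indep_below:
  assumes "matroid M"
  shows "finite (card ` {I \<in> indep M. I \<subseteq> X})" "card ` {I \<in> indep M. I \<subseteq> X} \<noteq> {}"
proof -
  have "finite (indep M)"
    using assms finite_subset[of "indep M" "Pow (ground M)"] by (auto simp: matroid_def)
  then show "finite (card ` {I \<in> indep M. I \<subseteq> X})" by auto
  show "card ` {I \<in> indep M. I \<subseteq> X} \<noteq> {}" using assms by (auto simp: matroid_def)
qed

lemma rank_of_mono:
  assumes "matroid M" "X \<subseteq> Y"
  shows "rank_of M X \<le> rank_of M Y"
  unfolding rank_of_def
  using assms by (intro Max_mono finite_indep_below) auto

lemma finite_flats:
  assumes "matroid M"
  shows "finite (flats M)"
  using assms finite_subset[of "flats M" "Pow (ground M)"] by (auto simp: matroid_def flats_def)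

lemma ground_in_flats: "ground M \<in> flats M"
  by (simp add: flats_def)

lemma restriction_ground:
  assumes "matroid M"
  shows "restriction M (ground M) = M"
  using assms by (cases M) (auto simp: restriction_def matroid_def)

lemma matroid_restriction:
  assumes M: "matroid M" and F: "F \<subseteq> ground M"
  shows "matroid (restriction M F)"
proof -
  note m = M[unfolded matroid_def]
  note fin = m[THEN conjunct1]
    and empty = m[THEN conjunct2, THEN conjunct2, THEN conjunct1]
    and sub = m[THEN conjunct2, THEN conjunct2, THEN conjunct2, THEN conjunct1]
    and aug = m[THEN conjunct2, THEN conjunct2, THEN conjunct2, THEN conjunct2]
  have "finite F" by (rule finite_subset[OF F fin])
  moreover have "{I \<in> indep M. I \<subseteq> F} \<subseteq> Pow F" by blast
  moreover have "{} \<in> {I \<in> indep M. I \<subseteq> F}" using empty by blast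
  moreover have "\<forall>I\<in>{I \<in> indep M. I \<subseteq> F}. \<forall>J. J \<subseteq> I \<longrightarrow> J \<in> {I \<in> indep M. I \<subseteq> F}"
  proof (intro ballI allI impI)
    fix I J
    assume "I \<in> {I \<in> indep M. I \<subseteq> F}" "J \<subseteq> I"
    then have "I \<in> indep M" "J \<subseteq> F" by auto
    then show "J \<in> {I \<in> indep M. I \<subseteq> F}" using sub \<open>J \<subseteq> I\<close> by simp
  qed
  moreover have "\<forall>I\<in>{I \<in> indep M. I \<subseteq> F}. \<forall>J\<in>{I \<in> indep M. I \<subseteq> F}.
      card I < card J \<longrightarrow> (\<exists>e\<in>J - I. insert e I \<in> {I \<in> indep M. I \<subseteq> F})"
  proof (intro ballI impI)
    fix I J
    assume *: "I \<in> {I \<in> indep M. I \<subseteq> F}" "J \<in> {I \<in> indep M. I \<subseteq> F}" "card I < card J"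
    with aug obtain e where "e \<in> J - I" "insert e I \<in> indep M" by blast
    with * show "\<exists>e\<in>J - I. insert e I \<in> {I \<in> indep M. I \<subseteq> F}" by blast
  qed
  ultimately show ?thesis
    unfolding matroid_def restriction_def set_system.simps by (intro conjI)
qed

lemma loopless_restriction:
  assumes "loopless M" "F \<subseteq> ground M"
  shows "loopless (restriction M F)"
  using assms by (auto simp: loopless_def restriction_def)

lemma rk_restriction: "rk (restriction M F) = rank_of M F"
proof -
  have "{I \<in> indep (restriction M F). I \<subseteq> ground (restriction M F)} = {I \<in> indep M. I \<subseteq> F}"
    by (auto simp: restriction_def)
  then show ?thesis by (simp add: rank_of_def)
qed

lemma proper_flat:
  assumes "matroid M" "F \<in> flats M - {ground M}"
  shows "F \<subset> ground M" "rank_of M F < rk M"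
proof -
  show "F \<subset> ground M" using assms by (auto simp: flats_def)
  then obtain e where "e \<in> ground M - F" by blast
  with assms(2) have "rank_of M F < rank_of M (insert e F)" by (simp add: flats_def)
  also have "\<dots> \<le> rk M"
    using assms \<open>e \<in> _\<close> \<open>F \<subset> _\<close> by (intro rank_of_mono) auto
  finally show "rank_of M F < rk M" .
qed

lemma moebius_value_contraction_ground: "moebius_value (contraction M (ground M)) = 1"
  by (simp add: moebius_value_def contraction_def moebius.simps)

definition KL_sum_proper :: "('a set_system \<Rightarrow> int poly) \<Rightarrow> 'a set_system \<Rightarrow> int poly" where
  "KL_sum_proper Q M =
     (\<Sum>F\<in>flats M - {ground M}.
        smult ((- 1) ^ (rk M - rank_of M F) * moebius_value (contraction M F))
          (monom 1 (rk M - rank_of M F) * Q (restriction M F)))"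

lemma KL_sum_split:
  assumes "matroid M"
  shows "KL_sum Q M = Q M + KL_sum_proper Q M"
  unfolding KL_sum_def KL_sum_proper_def
  by (subst sum.remove[OF finite_flats[OF assms] ground_in_flats])
     (simp add: restriction_ground[OF assms] moebius_value_contraction_ground monom_0)

lemma rk_0_loopless:
  assumes "matroid M" "loopless M" "rk M = 0"
  shows "ground M = {}"
proof (rule ccontr)
  assume "ground M \<noteq> {}"
  then obtain e where e: "e \<in> ground M" by blast
  then have "{e} \<in> {I \<in> indep M. I \<subseteq> ground M}" using assms by (auto simp: loopless_def)
  then have "card {e} \<le> rk M"
    unfolding rank_of_def by (intro Max_ge finite_indep_below assms) blast
  with assms show False by simp
qed

definition lower_part :: "nat \<Rightarrow> int poly \<Rightarrow> int poly" where
  "lower_part r S = (\<Sum>j | 2 * j < r. monom (coeff S (r - j) - coeff S j) j)"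

lemma coeff_lower_part:
  "coeff (lower_part r S) i = (if 2 * i < r then coeff S (r - i) - coeff S i else 0)"
proof -
  have "finite {j. 2 * j < r}" by (rule finite_subset[of _ "{..<r}"]) auto
  then show ?thesis
    by (auto simp: lower_part_def coeff_sum sum.delta)
qed

lemma degree_lower_part:
  assumes "r > 0"
  shows "2 * degree (lower_part r S) < r"
proof (rule ccontr)
  assume *: "\<not> 2 * degree (lower_part r S) < r"
  then have "lead_coeff (lower_part r S) = 0" by (subst coeff_lower_part) simp
  with * assms show False by simp
qed

lemma palindromic_iff_lower_part:
  assumes "2 * degree q < r" "degree S \<le> r"
  shows "palindromic r (q + S) \<longleftrightarrow> q = lower_part r S"
proof
  have q0: "coeff q i = 0" if "\<not> 2 * i < r" for i
    using that assms(1) by (intro coeff_eq_0) auto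
  assume "palindromic r (q + S)"
  then have *: "coeff q i + coeff S i = coeff q (r - i) + coeff S (r - i)" if "i \<le> r" for i
    using that unfolding palindromic_iff_coeff coeff_add by blast
  show "q = lower_part r S"
  proof (rule poly_eqI)
    fix i
    show "coeff q i = coeff (lower_part r S) i"
    proof (cases "2 * i < r")
      case True
      then have "coeff q (r - i) = 0" by (intro q0) auto
      with *[of i] True show ?thesis by (simp add: coeff_lower_part)
    qed (simp add: coeff_lower_part q0)
  qed
next
  assume q: "q = lower_part r S"
  have "degree (q + S) \<le> r" using assms by (intro degree_add_le) auto
  moreover have "coeff (q + S) i = coeff (q + S) (r - i)" if "i \<le> r" for i
  proof -
    consider "2 * i < r" | "2 * i = r" | "2 * i > r" by linarith
    then show ?thesis
    proof cases
      case 2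
      then have "r - i = i" by auto
      then show ?thesis by simp
    qed (use that in \<open>auto simp: q coeff_lower_part\<close>)
  qed
  ultimately show "palindromic r (q + S)" unfolding palindromic_iff_coeff by blast
qed

lemma degree_KL_sum_proper:
  assumes "matroid M"
    and "\<And>F. F \<in> flats M - {ground M} \<Longrightarrow> degree (Q (restriction M F)) \<le> rank_of M F"
  shows "degree (KL_sum_proper Q M) \<le> rk M"
  unfolding KL_sum_proper_def
proof (rule degree_sum_le)
  show "finite (flats M - {ground M})" using finite_flats[OF assms(1)] by simp
  fix F
  assume F: "F \<in> flats M - {ground M}"
  have "degree (monom 1 (rk M - rank_of M F) * Q (restriction M F)) \<le>
      (rk M - rank_of M F) + degree (Q (restriction M F))"
    using degree_mult_le[of "monom (1::int) (rk M - rank_of M F)" "Q (restriction M F)"]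
    by (simp add: degree_monom_eq)
  also have "\<dots> \<le> rk M" using assms(2)[OF F] proper_flat[OF assms(1) F] by simp
  finally show "degree (smult ((- 1) ^ (rk M - rank_of M F) * moebius_value (contraction M F))
      (monom 1 (rk M - rank_of M F) * Q (restriction M F))) \<le> rk M"
    using degree_smult_le le_trans by blast
qed

text \<open>An explicit recursion for the assignment.\<close>

function KL_rec :: "'a set_system \<Rightarrow> int poly" where
  "KL_rec M =
     (if \<not> (matroid M \<and> loopless M) then 0
      else if rk M = 0 then 1
      else lower_part (rk M)
        (\<Sum>F\<in>{F \<in> flats M. F \<subset> ground M \<and> finite (ground M)}.
          smult ((- 1) ^ (rk M - rank_of M F) * moebius_value (contraction M F))
            (monom 1 (rk M - rank_of M F) * KL_rec (restriction M F))))"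
  by pat_completeness auto
termination
  by (relation "measure (\<lambda>M. card (ground M))")
     (auto simp: restriction_def intro!: psubset_card_mono)

declare KL_rec.simps [simp del]

lemma KL_rec_not_loopless_matroid: "\<not> (matroid M \<and> loopless M) \<Longrightarrow> KL_rec M = 0"
  by (subst KL_rec.simps) auto

lemma KL_rec_rk_0: "matroid M \<Longrightarrow> loopless M \<Longrightarrow> rk M = 0 \<Longrightarrow> KL_rec M = 1"
  by (subst KL_rec.simps) auto

lemma KL_rec_rk_pos:
  assumes "matroid M" "loopless M" "rk M > 0"
  shows "KL_rec M = lower_part (rk M) (KL_sum_proper KL_rec M)"
proof -
  have "{F \<in> flats M. F \<subset> ground M \<and> finite (ground M)} = flats M - {ground M}"
    using assms by (auto simp: matroid_def flats_def)
  then show ?thesis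
    using assms by (subst KL_rec.simps) (simp add: KL_sum_proper_def)
qed

lemma inverse_KL_assignment_degree:
  assumes "\<And>M. matroid M \<Longrightarrow> loopless M \<Longrightarrow> rk M = 0 \<Longrightarrow> Q M = 1"
    and "\<And>M. matroid M \<Longrightarrow> loopless M \<Longrightarrow> rk M > 0 \<Longrightarrow> 2 * degree (Q M) < rk M"
    and "matroid M" "loopless M"
  shows "degree (KL_sum_proper Q M) \<le> rk M"
proof (rule degree_KL_sum_proper[OF assms(3)])
  fix F
  assume "F \<in> flats M - {ground M}"
  then have "F \<subseteq> ground M" using proper_flat[OF assms(3)] by blast
  then have *: "matroid (restriction M F)" "loopless (restriction M F)"
    using matroid_restriction[OF assms(3)] loopless_restriction[OF assms(4)] by blast+
  show "degree (Q (restriction M F)) \<le> rank_of M F"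
    using assms(1)[OF *] assms(2)[OF *] unfolding rk_restriction
    by (cases "rank_of M F = 0") auto
qed

lemma inverse_KL_assignment_KL_rec: "inverse_KL_assignment KL_rec"
proof -
  have deg: "2 * degree (KL_rec M) < rk M" if "matroid M" "loopless M" "rk M > 0"
    for M :: "'a set_system"
    using that by (simp add: KL_rec_rk_pos degree_lower_part)
  have "palindromic (rk M) (KL_sum KL_rec M)" if M: "matroid M" "loopless M"
    for M :: "'a set_system"
  proof (cases "rk M = 0")
    case True
    then have "ground M = {}" using rk_0_loopless M by blast
    then have "flats M - {ground M} = {}" by (auto simp: flats_def)
    then have "KL_sum_proper KL_rec M = 0" unfolding KL_sum_proper_def by (simp only: sum.empty)
    then have "KL_sum KL_rec M = 1"
      using KL_sum_split[OF M(1)] KL_rec_rk_0[OF M True] by simp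
    then show ?thesis
      using True by (simp add: palindromic_iff_coeff)
  next
    case False
    have "degree (KL_sum_proper KL_rec M) \<le> rk M"
      using KL_rec_rk_0 deg M by (rule inverse_KL_assignment_degree)
    moreover have pos: "rk M > 0" using False by blast
    ultimately show ?thesis
      unfolding KL_sum_split[OF M(1)]
      using palindromic_iff_lower_part[OF deg[OF M pos]] KL_rec_rk_pos[OF M pos] by blast
  qed
  moreover have "real (degree (KL_rec M)) < real (rk M) / 2"
    if "matroid M" "loopless M" "rk M > 0" for M :: "'a set_system"
    using deg[OF that] by linarith
  ultimately show ?thesis
    unfolding inverse_KL_assignment_def
    using KL_rec_rk_0 KL_rec_not_loopless_matroid by blast
qed

lemma inverse_KL_assignment_unique:
  assumes "inverse_KL_assignment Q"
  shows "Q M = KL_rec M"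
proof (induction "card (ground M)" arbitrary: M rule: less_induct)
  case less
  have q0: "Q N = 1" if "matroid N" "loopless N" "rk N = 0" for N
    using assms that unfolding inverse_KL_assignment_def by blast
  have deg: "2 * degree (Q N) < rk N" if "matroid N" "loopless N" "rk N > 0" for N
  proof -
    have "real (degree (Q N)) < real (rk N) / 2"
      using assms that unfolding inverse_KL_assignment_def by blast
    then show ?thesis by linarith
  qed
  show ?case
  proof (cases "matroid M \<and> loopless M")
    case False
    then have "Q M = 0" using assms unfolding inverse_KL_assignment_def by blast
    then show ?thesis using KL_rec_not_loopless_matroid[OF False] by simp
  next
    case M: True
    show ?thesis
    proof (cases "rk M = 0")
      case True
      with M show ?thesis using q0 KL_rec_rk_0 by metis
    next
      case False
      have "Q (restriction M F) = KL_rec (restriction M F)" if "F \<in> flats M - {ground M}" for F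
      proof (rule less)
        have "F \<subset> ground M" using proper_flat M that by blast
        moreover have "finite (ground M)" using M by (simp add: matroid_def)
        ultimately show "card (ground (restriction M F)) < card (ground M)"
          by (simp add: restriction_def psubset_card_mono)
      qed
      then have eq: "KL_sum_proper Q M = KL_sum_proper KL_rec M"
        unfolding KL_sum_proper_def by (intro sum.cong refl) (simp only:)
      have "degree (KL_sum_proper Q M) \<le> rk M"
        using q0 deg conjunct1[OF M] conjunct2[OF M] by (rule inverse_KL_assignment_degree)
      moreover have "palindromic (rk M) (Q M + KL_sum_proper Q M)"
        using assms M unfolding inverse_KL_assignment_def KL_sum_split[OF conjunct1[OF M], symmetric]
        by blast
      moreover have "2 * degree (Q M) < rk M" using deg M False by blast
      ultimately have "Q M = lower_part (rk M) (KL_sum_proper Q M)"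
        using palindromic_iff_lower_part by blast
      also have "\<dots> = KL_rec M"
        using M False unfolding eq by (intro KL_rec_rk_pos[symmetric]) auto
      finally show ?thesis .
    qed
  qed
qed

theorem ex1_inverse_KL_assignment: "\<exists>!Q. inverse_KL_assignment Q"
  using inverse_KL_assignment_KL_rec inverse_KL_assignment_unique
  by (intro ex1I[of _ KL_rec]) (auto simp: fun_eq_iff)

lemma inverse_KL_assignment_inverse_KL: "inverse_KL_assignment inverse_KL"
  unfolding inverse_KL_def by (rule theI'[OF ex1_inverse_KL_assignment])

end

(* The witness is the dual of the rank two matroid on 21 elements whose parallel classes have sizes
   15, 3, 3. If M is dual to a rank function r on E, the flats of M are the complements of the sets Y
   on which r has no coloops; M/(E - Y) is dual to r on Y, so by Rota's crosscut theorem its Moebius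
   value is an alternating count of the r-independent subsets of Y. That count vanishes when Y has a
   coloop, so the defining sum of Q may be taken over all subsets Y of E. For r of rank two every
   restriction to a proper flat is a circuit with coloops or free, and everything is binomial.
   A real-rooted polynomial satisfies the Laguerre inequality p p'' <= p'^2 on the real line; the
   normalization of Q violates it at x = -1. *)
theory Submission
  imports Defs "HOL-Computational_Algebra.Fundamental_Theorem_Algebra"
begin

section \<open>Moebius values as alternating sums over spanning sets\<close>

text \<open>Restricting the dual of \<open>r\<close> to \<open>E - Y\<close> dualizes the
  contraction of \<open>r\<close> by \<open>Y\<close>, which has rank r(E) - r(Y). If
  \<open>r\<close> has rank two and no loops, a nonempty \<open>Y\<close> leaves rank one or zero,
  so the recursion for \<open>inverse_KL\<close> stops after one intermediate layer, a family
  indexed by circuit size alone: each coloop merely multiplies the palindromic sum by 1 + x. The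
  obstacle is that the complements of flats form an irregular family over which sums do not factor.
  Over all subsets they become products and binomial sums, hence the weight on the Moebius side has
  to make sense, and vanish, on every other subset. For the witness the intermediate circuits have
  sizes 18 = 15 + 3 and 6 = 3 + 3, the complements of the classes. The polynomial attains degree 9,
  the largest allowed in rank 19. The point -1 is almost a critical point of its normalization, with
  value and second derivative both negative; a real-rooted polynomial has no local maximum of this
  kind below the axis.\<close>

lemma sum_Pow_minus_one:
  assumes "finite F"
  shows "(\<Sum>A\<in>Pow F. (- 1) ^ card A) = (if F = {} then 1 else 0 :: int)"
  using assms
proof (induction F rule: finite_induct)
  case (insert x F)
  have "Pow (insert x F) = Pow F \<union> insert x ` Pow F" by (rule Pow_insert)
  moreover have "Pow F \<inter> insert x ` Pow F = {}" using insert by auto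
  moreover have "inj_on (insert x) (Pow F)" using insert by (auto simp: inj_on_def)
  moreover have "(- 1 :: int) ^ card (insert x A) = - ((- 1) ^ card A)" if "A \<in> Pow F" for A
  proof -
    have "finite A" "x \<notin> A" using that insert finite_subset by auto
    then show ?thesis by simp
  qed
  ultimately show ?case
    using insert.hyps by (simp add: sum.union_disjoint sum.reindex sum_negf)
qed simp

section \<open>Rank, bases and closure in a finite matroid\<close>

lemma rank_of_indep_le:
  assumes "matroid M" "I \<in> indep M" "I \<subseteq> X"
  shows "card I \<le> rank_of M X"
  unfolding rank_of_def using assms by (intro Max_ge finite_indep_below) auto

lemma rank_of_attained:
  assumes "matroid M"
  obtains B where "B \<in> indep M" "B \<subseteq> X" "card B = rank_of M X"
proof -
  have "rank_of M X \<in> card ` {I \<in> indep M. I \<subseteq> X}"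
    unfolding rank_of_def using finite_indep_below[OF assms] by (rule Max_in)
  then show thesis using that by auto
qed

lemma rank_of_le:
  assumes "matroid M" "\<And>I. I \<in> indep M \<Longrightarrow> I \<subseteq> X \<Longrightarrow> card I \<le> n"
  shows "rank_of M X \<le> n"
  using assms by (metis rank_of_attained)

lemma indep_finite: "matroid M \<Longrightarrow> I \<in> indep M \<Longrightarrow> finite I"
  by (auto simp: matroid_def intro: finite_subset)

lemma indep_subset: "matroid M \<Longrightarrow> I \<in> indep M \<Longrightarrow> J \<subseteq> I \<Longrightarrow> J \<in> indep M"
  by (auto simp: matroid_def)

lemma indep_augment:
  "matroid M \<Longrightarrow> I \<in> indep M \<Longrightarrow> J \<in> indep M \<Longrightarrow> card I < card J \<Longrightarrow>
    \<exists>e\<in>J - I. insert e I \<in> indep M"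
  by (auto simp: matroid_def)

lemma indep_extend_basis:
  assumes "matroid M" "I \<in> indep M" "I \<subseteq> X"
  obtains B where "B \<in> indep M" "I \<subseteq> B" "B \<subseteq> X" "card B = rank_of M X"
proof -
  have "\<exists>B. B \<in> indep M \<and> I \<subseteq> B \<and> B \<subseteq> X \<and> card B = rank_of M X"
    using assms(2,3)
  proof (induction "rank_of M X - card I" arbitrary: I rule: less_induct)
    case less
    show ?case
    proof (cases "card I = rank_of M X")
      case True
      with less show ?thesis by blast
    next
      case False
      then have lt: "card I < rank_of M X"
        using rank_of_indep_le[OF assms(1) less.prems] by simp
      obtain J where J: "J \<in> indep M" "J \<subseteq> X" "card J = rank_of M X"
        using rank_of_attained[OF assms(1)] by blast
      obtain e where e: "e \<in> J - I" "insert e I \<in> indep M"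
        using indep_augment[OF assms(1) less.prems(1) J(1)] lt J(3) by auto
      have "card (insert e I) = Suc (card I)"
        using e indep_finite[OF assms(1) less.prems(1)] by simp
      moreover have "insert e I \<subseteq> X" using e J(2) less.prems(2) by auto
      moreover have "rank_of M X - Suc (card I) < rank_of M X - card I" using lt by simp
      ultimately show ?thesis
        using less.hyps[of "insert e I"] e(2) by auto
    qed
  qed
  then show thesis using that by blast
qed

definition span_of :: "'a set_system \<Rightarrow> 'a set \<Rightarrow> 'a set" where
  "span_of M A = {e \<in> ground M. rank_of M (insert e A) = rank_of M A}"

lemma span_of_superset:
  assumes "A \<subseteq> ground M"
  shows "A \<subseteq> span_of M A"
  using assms by (auto simp: span_of_def insert_absorb)

text \<open>An independent subset of the closure larger than a basis \<open>B\<close> of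
  \<open>A\<close> would augment \<open>B\<close> by some \<open>e\<close> of the closure, and
  \<open>insert e A\<close> would have larger rank than \<open>A\<close>.\<close>

lemma rank_of_span_of:
  assumes "matroid M" "A \<subseteq> ground M"
  shows "rank_of M (span_of M A) = rank_of M A"
proof (rule antisym)
  show "rank_of M A \<le> rank_of M (span_of M A)"
    using assms by (intro rank_of_mono span_of_superset)
  obtain B where B: "B \<in> indep M" "B \<subseteq> A" "card B = rank_of M A"
    using rank_of_attained[OF assms(1)] .
  show "rank_of M (span_of M A) \<le> rank_of M A"
  proof (rule rank_of_le[OF assms(1)], rule ccontr)
    fix J
    assume J: "J \<in> indep M" "J \<subseteq> span_of M A" "\<not> card J \<le> rank_of M A"
    then obtain e where e: "e \<in> J - B" "insert e B \<in> indep M"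
      using indep_augment[OF assms(1) B(1) J(1)] B(3) by auto
    then have "rank_of M (insert e A) = rank_of M A" using J(2) by (auto simp: span_of_def)
    moreover have "card (insert e B) \<le> rank_of M (insert e A)"
      using e B(2) by (intro rank_of_indep_le[OF assms(1)]) auto
    ultimately show False using e B(3) indep_finite[OF assms(1) B(1)] by simp
  qed
qed

lemma span_of_flat:
  assumes "matroid M" "A \<subseteq> ground M"
  shows "span_of M A \<in> flats M"
proof -
  have "rank_of M (span_of M A) < rank_of M (insert e (span_of M A))"
    if e: "e \<in> ground M - span_of M A" for e
  proof -
    have "rank_of M A \<noteq> rank_of M (insert e A)" using e by (auto simp: span_of_def)
    moreover have "rank_of M A \<le> rank_of M (insert e A)"
      by (intro rank_of_mono[OF assms(1)]) auto
    moreover have "rank_of M (insert e A) \<le> rank_of M (insert e (span_of M A))"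
      using span_of_superset[OF assms(2)] by (intro rank_of_mono[OF assms(1)]) auto
    ultimately show ?thesis using rank_of_span_of[OF assms] by simp
  qed
  then show ?thesis by (auto simp: flats_def span_of_def)
qed

text \<open>Suppose \<open>e\<close> is in the closure of \<open>A\<close> but not in
  \<open>F\<close>. Extend a basis \<open>I\<close> of \<open>A\<close> to a basis \<open>B\<close>
  of \<open>F\<close>. As \<open>e\<close> raises the rank of the flat \<open>F\<close>,
  \<open>B\<close> can be augmented, and only by \<open>e\<close>; so \<open>insert e I\<close> is
  independent, against the choice of \<open>e\<close>.\<close>

lemma span_of_least:
  assumes "matroid M" "F \<in> flats M" "A \<subseteq> F"
  shows "span_of M A \<subseteq> F"
proof
  fix e
  assume e: "e \<in> span_of M A"
  obtain I where I: "I \<in> indep M" "I \<subseteq> A" "card I = rank_of M A"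
    using rank_of_attained[OF assms(1)] .
  obtain B where B: "B \<in> indep M" "I \<subseteq> B" "B \<subseteq> F" "card B = rank_of M F"
    using indep_extend_basis[OF assms(1) I(1)] I(2) assms(3) by blast
  show "e \<in> F"
  proof (rule ccontr)
    assume eF: "e \<notin> F"
    then have "rank_of M F < rank_of M (insert e F)"
      using e assms(2) by (auto simp: flats_def span_of_def)
    then obtain J where J: "J \<in> indep M" "J \<subseteq> insert e F" "card B < card J"
      using rank_of_attained[OF assms(1), of "insert e F"] B(4) by metis
    then obtain d where d: "d \<in> J - B" "insert d B \<in> indep M"
      using indep_augment[OF assms(1) B(1)] by blast
    have "d = e"
    proof (rule ccontr)
      assume "d \<noteq> e"
      then have "insert d B \<subseteq> F" using d J(2) B(3) by auto
      then have "card (insert d B) \<le> rank_of M F" by (rule rank_of_indep_le[OF assms(1) d(2)])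
      then show False using d B(4) indep_finite[OF assms(1) B(1)] by simp
    qed
    then have "insert e I \<in> indep M"
      using d B(2) indep_subset[OF assms(1) d(2)] by (meson insert_mono)
    then have "card (insert e I) \<le> rank_of M (insert e A)"
      using I(2) by (intro rank_of_indep_le[OF assms(1)]) auto
    moreover have "e \<notin> I" using eF I(2) assms(3) by auto
    ultimately show False
      using e I(3) indep_finite[OF assms(1) I(1)] by (simp add: span_of_def)
  qed
qed

lemma flat_rank_of_eq_imp_span_of:
  assumes "matroid M" "F \<in> flats M" "A \<subseteq> F" "rank_of M A = rank_of M F"
  shows "span_of M A = F"
proof
  show "span_of M A \<subseteq> F" by (rule span_of_least[OF assms(1-3)])
  show "F \<subseteq> span_of M A"
  proof
    fix e
    assume e: "e \<in> F"
    have "rank_of M A \<le> rank_of M (insert e A)" "rank_of M (insert e A) \<le> rank_of M F"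
      using e assms(3) by (auto intro!: rank_of_mono[OF assms(1)])
    then show "e \<in> span_of M A" using e assms(2,4) by (auto simp: span_of_def flats_def)
  qed
qed

text \<open>Grouping the subsets of a flat by their closure shows that the right-hand side satisfies the
  recursion defining the left-hand side.\<close>

lemma moebius_flats:
  assumes M: "matroid M" "loopless M" and "F \<in> flats M"
  shows "moebius (flats M) {} F = (\<Sum>A | A \<subseteq> F \<and> rank_of M A = rank_of M F. (- 1) ^ card A)"
  using \<open>F \<in> flats M\<close>
proof (induction "card F" arbitrary: F rule: less_induct)
  case less
  define T where "T G = {A. A \<subseteq> G \<and> rank_of M A = rank_of M G}" for G
  have fin: "finite G" if "G \<in> flats M" for G
    using that M by (auto simp: flats_def matroid_def intro: finite_subset)
  have finT: "finite (T G)" if "G \<in> flats M" for G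
    using fin[OF that] by (auto simp: T_def)
  have "span_of M A = G" if "G \<in> flats M" "A \<in> T G" for G A
    using flat_rank_of_eq_imp_span_of[OF M(1) that(1)] that(2) by (simp add: T_def)
  \<comment> \<open>\<open>T G\<close> collects sets whose closure is \<open>G\<close>, so these
    families partition \<open>Pow F\<close> along the flats inside \<open>F\<close>.\<close>
  then have disj: "T G \<inter> T H = {}" if "G \<in> flats M" "H \<in> flats M" "G \<noteq> H" for G H
    using that by blast
  have Pow: "(\<Union>G\<in>{G \<in> flats M. G \<subseteq> F}. T G) = Pow F"
  proof
    show "(\<Union>G\<in>{G \<in> flats M. G \<subseteq> F}. T G) \<subseteq> Pow F" by (auto simp: T_def)
    show "Pow F \<subseteq> (\<Union>G\<in>{G \<in> flats M. G \<subseteq> F}. T G)"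
    proof
      fix A
      assume "A \<in> Pow F"
      then have A: "A \<subseteq> F" "A \<subseteq> ground M" using less.prems by (auto simp: flats_def)
      have "A \<in> T (span_of M A)"
        using span_of_superset[OF A(2)] rank_of_span_of[OF M(1) A(2)] by (simp add: T_def)
      then show "A \<in> (\<Union>G\<in>{G \<in> flats M. G \<subseteq> F}. T G)"
        using span_of_flat[OF M(1) A(2)] span_of_least[OF M(1) less.prems A(1)] by blast
    qed
  qed
  have fl: "finite {G \<in> flats M. G \<subseteq> F}" using finite_flats[OF M(1)] by simp
  have "(\<Sum>G\<in>{G \<in> flats M. G \<subseteq> F}. \<Sum>A\<in>T G. (- 1) ^ card A) = (\<Sum>A\<in>Pow F. (- 1 :: int) ^ card A)"
    unfolding Pow[symmetric] using fl finT disj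
    by (intro sum.UNION_disjoint[symmetric]) auto
  also have "\<dots> = (if F = {} then 1 else 0)"
    using fin less.prems by (intro sum_Pow_minus_one)
  finally have total: "(\<Sum>G\<in>{G \<in> flats M. G \<subseteq> F}. \<Sum>A\<in>T G. (- 1 :: int) ^ card A) =
      (if F = {} then 1 else 0)" .
  have split: "{G \<in> flats M. G \<subseteq> F} = insert F {G \<in> flats M. {} \<subseteq> G \<and> G \<subset> F}"
    using less.prems by auto
  have IH: "moebius (flats M) {} G = (\<Sum>A\<in>T G. (- 1) ^ card A)" if "G \<in> flats M" "G \<subset> F" for G
    using less.hyps[of G] that fin[OF less.prems] unfolding T_def by (auto intro: psubset_card_mono)
  show ?case
  proof (cases "F = {}")
    case True
    have "{A. A = {} \<and> rank_of M A = rank_of M {}} = {{} :: 'a set}" by auto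
    then show ?thesis using True by (simp add: moebius.simps)
  next
    case False
    have "(\<Sum>A\<in>T F. (- 1 :: int) ^ card A) +
        (\<Sum>G\<in>{G \<in> flats M. {} \<subseteq> G \<and> G \<subset> F}. \<Sum>A\<in>T G. (- 1) ^ card A) = 0"
      using total[unfolded split] fl[unfolded split] False by (subst (asm) sum.insert) auto
    moreover have "moebius (flats M) {} F =
        - (\<Sum>G\<in>{G \<in> flats M. {} \<subseteq> G \<and> G \<subset> F}. moebius (flats M) {} G)"
      using False finite_flats[OF M(1)] by (subst moebius.simps) (auto simp: psubset_eq)
    moreover have "(\<Sum>G\<in>{G \<in> flats M. {} \<subseteq> G \<and> G \<subset> F}. moebius (flats M) {} G) =
        (\<Sum>G\<in>{G \<in> flats M. {} \<subseteq> G \<and> G \<subset> F}. \<Sum>A\<in>T G. (- 1) ^ card A)"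
      using IH by (intro sum.cong) auto
    ultimately show ?thesis by (simp add: T_def)
  qed
qed

corollary moebius_value_spanning:
  assumes "matroid M" "loopless M"
  shows "moebius_value M = (\<Sum>A | A \<subseteq> ground M \<and> rank_of M A = rk M. (- 1) ^ card A)"
  unfolding moebius_value_def by (rule moebius_flats[OF assms ground_in_flats])

section \<open>Duals of rank functions\<close>

text \<open>The rank function is defined on all sets, so one \<open>r\<close> serves every subset:
  \<open>dual_system r Y\<close> is the dual of the restriction of \<open>r\<close> to
  \<open>Y\<close>.\<close>

definition dual_system :: "('a set \<Rightarrow> nat) \<Rightarrow> 'a set \<Rightarrow> 'a set_system" where
  "dual_system r E = \<lparr>ground = E, indep = {X. X \<subseteq> E \<and> r (E - X) = r E}\<rparr>"

lemma ground_dual_system [simp]: "ground (dual_system r E) = E"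
  by (simp add: dual_system_def)

lemma indep_dual_system: "X \<in> indep (dual_system r E) \<longleftrightarrow> X \<subseteq> E \<and> r (E - X) = r E"
  by (simp add: dual_system_def)

text \<open>The finiteness guards keep the axioms true of \<open>class_rank\<close>: an infinite
  image has \<open>card\<close> 0, which would break monotonicity.\<close>

locale rank_function =
  fixes r :: "'a set \<Rightarrow> nat"
  assumes rank_empty: "r {} = 0"
    and rank_mono: "finite B \<Longrightarrow> A \<subseteq> B \<Longrightarrow> r A \<le> r B"
    and rank_insert_le: "finite A \<Longrightarrow> r (insert e A) \<le> Suc (r A)"
    and rank_submodular: "finite A \<Longrightarrow> finite B \<Longrightarrow> r (A \<union> B) + r (A \<inter> B) \<le> r A + r B"
begin

lemma rank_Un_le:
  assumes "finite A" "finite K"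
  shows "r (A \<union> K) \<le> r A + card K"
  using assms(2)
proof (induction K rule: finite_induct)
  case (insert x K)
  have "r (A \<union> insert x K) \<le> Suc (r (A \<union> K))"
    using rank_insert_le[of "A \<union> K" x] assms insert by simp
  with insert show ?case by simp
qed simp

lemma rank_le_card:
  assumes "finite K"
  shows "r K \<le> card K"
  using rank_Un_le[of "{}" K] assms by (simp add: rank_empty)

text \<open>Each coloop in \<open>K\<close> costs one unit of rank: \<open>A - K\<close> and
  \<open>A - {x}\<close> have union \<open>A\<close>, so submodularity transfers the drop at
  \<open>x\<close> from \<open>A\<close> to \<open>A - K\<close>.\<close>

lemma rank_minus_coloops:
  assumes "finite A" "K \<subseteq> A" "\<And>e. e \<in> K \<Longrightarrow> r (A - {e}) < r A"
  shows "r (A - K) + card K \<le> r A"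
proof -
  have "finite K" using assms finite_subset by blast
  then show ?thesis
    using assms(2,3)
  proof (induction K rule: finite_induct)
    case (insert x K)
    have "(A - K) \<union> (A - {x}) = A" "(A - K) \<inter> (A - {x}) = A - insert x K"
      using insert by auto
    then have "r A + r (A - insert x K) \<le> r (A - K) + r (A - {x})"
      using rank_submodular[of "A - K" "A - {x}"] assms(1) by simp
    moreover have "r (A - {x}) < r A" "r (A - K) + card K \<le> r A"
      using insert by auto
    ultimately show ?case using insert.hyps by simp
  qed simp
qed

context
  fixes E :: "'a set"
  assumes finE: "finite E"
begin

text \<open>For augmentation: if no element of \<open>J - I\<close> can be added to
  \<open>I\<close>, all of them are coloops of \<open>E - I\<close>. Deleting them costs |J - I|,
  while restoring \<open>I - J\<close> gains at most |I - J|, which is smaller; so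
  \<open>E - J\<close> could not span.\<close>

lemma matroid_dual_system: "matroid (dual_system r E)"
proof -
  have sub: "J \<in> indep (dual_system r E)" if I: "I \<in> indep (dual_system r E)" "J \<subseteq> I" for I J
  proof -
    have "r (E - I) \<le> r (E - J)" "r (E - J) \<le> r E"
      using that finE by (auto intro!: rank_mono)
    then show ?thesis using that by (auto simp: indep_dual_system)
  qed
  have aug: "\<exists>e\<in>J - I. insert e I \<in> indep (dual_system r E)"
    if I: "I \<in> indep (dual_system r E)" and J: "J \<in> indep (dual_system r E)"
      and lt: "card I < card J" for I J
  proof (rule ccontr)
    assume no: "\<not> (\<exists>e\<in>J - I. insert e I \<in> indep (dual_system r E))"
    have sub: "I \<subseteq> E" "J \<subseteq> E" using I J by (auto simp: indep_dual_system)
    have fin: "finite I" "finite J" using sub finE finite_subset by auto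
    have "r (E - I - {e}) < r (E - I)" if "e \<in> J - I" for e
    proof -
      have "E - I - {e} = E - insert e I" by auto
      moreover have "r (E - insert e I) \<noteq> r E" using no that sub by (auto simp: indep_dual_system)
      moreover have "r (E - insert e I) \<le> r E" using finE by (intro rank_mono) auto
      ultimately show ?thesis using I by (simp add: indep_dual_system)
    qed
    then have "r (E - I - (J - I)) + card (J - I) \<le> r (E - I)"
      using sub finE by (intro rank_minus_coloops) auto
    moreover have "r (E - J) \<le> r (E - I - (J - I)) + card (I - J)"
    proof -
      have "E - J = (E - I - (J - I)) \<union> (I - J)" using sub by auto
      then show ?thesis using rank_Un_le[of "E - I - (J - I)" "I - J"] finE fin by simp
    qed
    moreover have "card (I - J) < card (J - I)"
      using lt fin by (intro card_less_sym_Diff) auto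
    ultimately show False using I J by (simp add: indep_dual_system)
  qed
  show ?thesis
    unfolding matroid_def
  proof (intro conjI ballI allI impI)
    show "indep (dual_system r E) \<subseteq> Pow (ground (dual_system r E))"
      by (auto simp: indep_dual_system)
  qed (use finE sub aug in \<open>simp_all add: indep_dual_system[of "{}"]\<close>)
qed

text \<open>Maximality of \<open>B\<close> makes every element of \<open>X - B\<close> a coloop of
  the spanning set \<open>E - B\<close>, so deleting \<open>X - B\<close> costs exactly its
  cardinality.\<close>

lemma basis_in_dual_system:
  assumes "basis_in (dual_system r E) X B" "X \<subseteq> E"
  shows "r (E - X) + card (X - B) = r E"
proof (rule antisym)
  have B: "B \<subseteq> X" "r (E - B) = r E" "\<And>e. e \<in> X - B \<Longrightarrow> r (E - insert e B) \<noteq> r E"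
    using assms by (auto simp: basis_in_def indep_dual_system)
  have eq: "E - X = E - B - (X - B)" "E - B = (E - X) \<union> (X - B)"
    using B(1) assms(2) by auto
  have "r (E - B - {e}) < r (E - B)" if "e \<in> X - B" for e
  proof -
    have "E - B - {e} = E - insert e B" by auto
    moreover have "r (E - insert e B) \<le> r E" using finE by (intro rank_mono) auto
    ultimately show ?thesis using B(2,3) that by (simp add: le_neq_implies_less)
  qed
  then show "r (E - X) + card (X - B) \<le> r E"
    unfolding eq(1) B(2)[symmetric] using assms(2) finE by (intro rank_minus_coloops) auto
  have "finite (X - B)" using assms(2) finE finite_subset by blast
  then show "r E \<le> r (E - X) + card (X - B)"
    using rank_Un_le[of "E - X" "X - B"] finE eq(2) B(2) by simp
qed

text \<open>The usual formula for the dual rank, arranged as a sum to avoid truncated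
  subtraction.\<close>

lemma rank_of_dual_system:
  assumes "X \<subseteq> E"
  shows "rank_of (dual_system r E) X + r E = card X + r (E - X)"
proof -
  obtain B where B: "B \<in> indep (dual_system r E)" "B \<subseteq> X" "card B = rank_of (dual_system r E) X"
    using rank_of_attained[OF matroid_dual_system] .
  have fin: "finite X" "finite B" using assms B(2) finE by (auto intro: finite_subset)
  have "basis_in (dual_system r E) X B"
    unfolding basis_in_def
  proof (intro conjI ballI notI)
    fix e
    assume e: "e \<in> X - B" "insert e B \<in> indep (dual_system r E)"
    then have "card (insert e B) \<le> rank_of (dual_system r E) X"
      using B(2) by (intro rank_of_indep_le matroid_dual_system) auto
    then show False using e B(3) fin by simp
  qed (use B in auto)
  then have "r (E - X) + card (X - B) = r E" using assms by (rule basis_in_dual_system)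
  moreover have "card X = card B + card (X - B)"
    using B(2) fin by (metis card_Diff_subset card_mono le_add_diff_inverse)
  ultimately show ?thesis using B(3) by simp
qed

lemma rk_dual_system: "rk (dual_system r E) = card E - r E"
  using rank_of_dual_system[of E] by (simp add: rank_empty)

text \<open>By the dual rank formula, adding \<open>e\<close> from \<open>Y\<close> to
  \<open>E - Y\<close> changes the rank by 1 + r(Y - e) - r(Y), which is positive exactly when
  \<open>e\<close> is not a coloop of \<open>Y\<close>.\<close>

lemma flats_dual_system:
  "flats (dual_system r E) = (\<lambda>Y. E - Y) ` {Y. Y \<subseteq> E \<and> (\<forall>e\<in>Y. r (Y - {e}) = r Y)}"
proof -
  have key: "E - Y \<in> flats (dual_system r E) \<longleftrightarrow> (\<forall>e\<in>Y. r (Y - {e}) = r Y)" if Y: "Y \<subseteq> E" for Y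
  proof -
    have "rank_of (dual_system r E) (E - Y) < rank_of (dual_system r E) (insert e (E - Y)) \<longleftrightarrow>
        r (Y - {e}) = r Y" if e: "e \<in> Y" for e
    proof -
      have eq: "E - (E - Y) = Y" "E - insert e (E - Y) = Y - {e}" using Y by auto
      have "card (insert e (E - Y)) = Suc (card (E - Y))" using e finE by simp
      moreover have "rank_of (dual_system r E) (insert e (E - Y)) + r E =
          card (insert e (E - Y)) + r (Y - {e})"
        using rank_of_dual_system[of "insert e (E - Y)"] e Y eq by auto
      moreover have "rank_of (dual_system r E) (E - Y) + r E = card (E - Y) + r Y"
        using rank_of_dual_system[of "E - Y"] eq by auto
      moreover have "r (Y - {e}) \<le> r Y" "r Y \<le> Suc (r (Y - {e}))"
        using finite_subset[OF Y finE] e rank_insert_le[of "Y - {e}" e]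
        by (auto intro!: rank_mono simp: insert_absorb)
      ultimately show ?thesis by linarith
    qed
    moreover have "E - (E - Y) = Y" using Y by auto
    ultimately show ?thesis by (auto simp: flats_def)
  qed
  show ?thesis
  proof (intro equalityI subsetI)
    fix F
    assume F: "F \<in> flats (dual_system r E)"
    then have "F = E - (E - F)" by (auto simp: flats_def)
    then show "F \<in> (\<lambda>Y. E - Y) ` {Y. Y \<subseteq> E \<and> (\<forall>e\<in>Y. r (Y - {e}) = r Y)}"
      using key[of "E - F"] F by auto
  qed (use key in auto)
qed

lemma contraction_dual_system:
  assumes Y: "Y \<subseteq> E"
  shows "contraction (dual_system r E) (E - Y) = dual_system r Y"
proof -
  have finY: "finite Y" using Y finE finite_subset by blast
  have iff: "I \<union> B \<in> indep (dual_system r E) \<longleftrightarrow> r (Y - I) = r Y"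
    if B: "basis_in (dual_system r E) (E - Y) B" and I: "I \<subseteq> Y" for I B
  proof -
    \<comment> \<open>\<open>r Y + card Z = r E\<close> says that \<open>Z\<close> adds its full
      cardinality to the rank of \<open>Y\<close>, hence by submodularity also to that of
      \<open>Y - I\<close>. So the complement of \<open>I \<union> B\<close>, which is
      \<open>(Y - I) \<union> Z\<close>, spans iff \<open>Y - I\<close> spans \<open>Y\<close>,
      whichever basis \<open>B\<close> was chosen.\<close>
    define Z where "Z = E - Y - B"
    have sub: "B \<subseteq> E - Y" "r (E - B) = r E"
      using B by (auto simp: basis_in_def indep_dual_system)
    have finZ: "finite Z" using finE by (simp add: Z_def)
    have "E - (E - Y) = Y" using Y by auto
    then have card: "r Y + card Z = r E"
      using basis_in_dual_system[OF B] by (simp add: Z_def)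
    have eq: "E - (I \<union> B) = (Y - I) \<union> Z" "E - B = Y \<union> ((Y - I) \<union> Z)"
        "Y \<inter> ((Y - I) \<union> Z) = Y - I"
      using sub(1) Y I by (auto simp: Z_def)
    have "r ((Y - I) \<union> Z) \<le> r (Y - I) + card Z"
      using finY finZ by (intro rank_Un_le) auto
    moreover have "r E + r (Y - I) \<le> r Y + r ((Y - I) \<union> Z)"
      using rank_submodular[of Y "(Y - I) \<union> Z"] finY finZ sub(2) eq by simp
    moreover have "r (Y - I) \<le> r Y" using finY by (intro rank_mono) auto
    moreover have "r ((Y - I) \<union> Z) \<le> r E"
      using finE Y by (intro rank_mono) (auto simp: Z_def)
    moreover have "I \<union> B \<subseteq> E" using I Y sub(1) by auto
    ultimately show ?thesis using card eq(1) by (auto simp: indep_dual_system)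
  qed
  obtain B where B: "B \<in> indep (dual_system r E)" "B \<subseteq> E - Y"
      "card B = rank_of (dual_system r E) (E - Y)"
    using rank_of_attained[OF matroid_dual_system] .
  have "basis_in (dual_system r E) (E - Y) B"
    unfolding basis_in_def
  proof (intro conjI ballI notI)
    fix e
    assume e: "e \<in> E - Y - B" "insert e B \<in> indep (dual_system r E)"
    then have "card (insert e B) \<le> rank_of (dual_system r E) (E - Y)"
      using B(2) by (intro rank_of_indep_le matroid_dual_system) auto
    moreover have "finite B" using B(1) by (rule indep_finite[OF matroid_dual_system])
    ultimately show False using e B(3) by simp
  qed (use B in auto)
  then have "(\<exists>B. basis_in (dual_system r E) (E - Y) B \<and> I \<union> B \<in> indep (dual_system r E)) \<longleftrightarrow>
      r (Y - I) = r Y" if "I \<subseteq> Y" for I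
    using iff[OF _ that] by metis
  moreover have "E - (E - Y) = Y" using Y by auto
  ultimately show ?thesis
    by (auto simp: contraction_def dual_system_def[of r Y])
qed

lemma loopless_dual_system:
  "loopless (dual_system r E) \<longleftrightarrow> (\<forall>e\<in>E. r (E - {e}) = r E)"
  by (auto simp: loopless_def indep_dual_system)

text \<open>Complements of spanning sets of the dual are the independent sets of \<open>r\<close>.
  The hypothesis, absence of coloops, is looplessness of the dual.\<close>

lemma moebius_value_dual_system:
  assumes "\<forall>e\<in>E. r (E - {e}) = r E"
  shows "moebius_value (dual_system r E) =
    (\<Sum>I | I \<subseteq> E \<and> r I = card I. (- 1) ^ (card E - card I))"
proof -
  have "moebius_value (dual_system r E) =
      (\<Sum>A | A \<subseteq> E \<and> rank_of (dual_system r E) A = card E - r E. (- 1) ^ card A)"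
    using moebius_value_spanning[OF matroid_dual_system] assms
    by (simp add: loopless_dual_system rk_dual_system[symmetric])
  also have "\<dots> = (\<Sum>I | I \<subseteq> E \<and> r I = card I. (- 1) ^ (card E - card I))"
  proof (rule sum.reindex_bij_witness[of _ "\<lambda>I. E - I" "\<lambda>A. E - A"])
    fix A
    assume "A \<in> {A. A \<subseteq> E \<and> rank_of (dual_system r E) A = card E - r E}"
    then have A: "A \<subseteq> E" "rank_of (dual_system r E) A = card E - r E" by auto
    have "r E \<le> card E" by (rule rank_le_card[OF finE])
    moreover have "card (E - A) = card E - card A" "card A \<le> card E"
      using A finE by (auto simp: card_Diff_subset finite_subset card_mono)
    ultimately show "E - A \<in> {I. I \<subseteq> E \<and> r I = card I}"
        "(- 1 :: int) ^ (card E - card (E - A)) = (- 1) ^ card A"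
      using rank_of_dual_system[OF A(1)] A(2) by auto
  next
    fix I
    assume "I \<in> {I. I \<subseteq> E \<and> r I = card I}"
    then have I: "I \<subseteq> E" "r I = card I" by auto
    have "r E \<le> card E" by (rule rank_le_card[OF finE])
    moreover have "card (E - I) = card E - card I" "card I \<le> card E" "E - (E - I) = I"
      using I finE by (auto simp: card_Diff_subset finite_subset card_mono)
    ultimately show "E - I \<in> {A. A \<subseteq> E \<and> rank_of (dual_system r E) A = card E - r E}"
      using rank_of_dual_system[of "E - I"] I(2) by auto
  qed auto
  finally show ?thesis .
qed

end

end

text \<open>Minus the reduced Euler characteristic of the independence complex of \<open>r\<close>
  on \<open>Y\<close>. For \<open>Y\<close> without coloops it is the Moebius value of the dual up
  to the sign (-1)^|Y|, but it is meaningful for every \<open>Y\<close>.\<close>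

definition signed_indep_count :: "('a set \<Rightarrow> nat) \<Rightarrow> 'a set \<Rightarrow> int" where
  "signed_indep_count r Y = (\<Sum>I | I \<subseteq> Y \<and> r I = card I. (- 1) ^ card I)"

context rank_function
begin

lemma rank_eq_card_subset:
  assumes "finite I" "r I = card I" "J \<subseteq> I"
  shows "r J = card J"
proof -
  have fin: "finite J" "finite (I - J)" using assms by (auto intro: finite_subset)
  have "r (J \<union> (I - J)) \<le> r J + card (I - J)" using fin by (rule rank_Un_le)
  moreover have "J \<union> (I - J) = I" using assms by auto
  moreover have "card I = card J + card (I - J)"
    using assms(1,3) fin by (metis card_Diff_subset card_mono le_add_diff_inverse)
  moreover have "r J \<le> card J" using fin by (intro rank_le_card)
  ultimately show ?thesis using assms(2) by simp
qed

text \<open>A coloop \<open>e\<close> can be added to or removed from any independent set, so the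
  independence complex is a cone with apex \<open>e\<close> and the terms cancel in pairs.\<close>

lemma signed_indep_count_coloop:
  assumes "finite Y" "e \<in> Y" "r (Y - {e}) \<noteq> r Y"
  shows "signed_indep_count r Y = 0"
proof -
  define A where "A = {I. I \<subseteq> Y - {e} \<and> r I = card I}"
  have finA: "finite A" using assms(1) by (simp add: A_def)
  have insert: "r (insert e I) = card (insert e I)" if "I \<in> A" for I
  proof -
    have I: "I \<subseteq> Y - {e}" "r I = card I" "finite I"
      using that assms(1) by (auto simp: A_def intro: finite_subset)
    have "(Y - {e}) \<union> insert e I = Y" "(Y - {e}) \<inter> insert e I = I" using I assms(2) by auto
    then have "r Y + r I \<le> r (Y - {e}) + r (insert e I)"
      using rank_submodular[of "Y - {e}" "insert e I"] assms(1) I(3) by simp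
    moreover have "r (Y - {e}) \<le> r Y" using assms(1) by (intro rank_mono) auto
    moreover have "r (insert e I) \<le> card (insert e I)" using I(3) by (intro rank_le_card) simp
    moreover have "card (insert e I) = Suc (card I)"
    proof -
      have "e \<notin> I" using I(1) by auto
      then show ?thesis using I(3) by simp
    qed
    ultimately show ?thesis using assms(3) I(2) by linarith
  qed
  have "{I. I \<subseteq> Y \<and> r I = card I} = A \<union> insert e ` A"
  proof (intro equalityI subsetI)
    fix I
    assume I: "I \<in> {I. I \<subseteq> Y \<and> r I = card I}"
    then have "finite I" using assms(1) by (auto intro: finite_subset)
    then have "r (I - {e}) = card (I - {e})" using rank_eq_card_subset[of I "I - {e}"] I by auto
    then have "I - {e} \<in> A" using I by (auto simp: A_def)
    moreover have "I = (if e \<in> I then insert e (I - {e}) else I - {e})" by auto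
    ultimately show "I \<in> A \<union> insert e ` A" by (metis UnI1 UnI2 imageI)
  next
    fix I
    assume "I \<in> A \<union> insert e ` A"
    then show "I \<in> {I. I \<subseteq> Y \<and> r I = card I}"
      using insert assms(2) by (auto simp: A_def)
  qed
  moreover have "A \<inter> insert e ` A = {}" by (auto simp: A_def)
  moreover have "inj_on (insert e) A" by (auto simp: inj_on_def A_def)
  moreover have "(- 1 :: int) ^ card (insert e I) = - ((- 1) ^ card I)" if "I \<in> A" for I
  proof -
    have "finite I" "e \<notin> I" using that assms(1) by (auto simp: A_def intro: finite_subset)
    then show ?thesis by simp
  qed
  ultimately show ?thesis
    unfolding signed_indep_count_def
    using finA by (simp add: sum.union_disjoint sum.reindex sum_negf)
qed

text \<open>\<open>Y\<close> stands for the flat \<open>E - Y\<close>, and \<open>{}\<close> for the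
  omitted full ground set. In the product of (-1)^(|Y| - r(Y)) and (-1)^(|Y| - |I|) the size of
  \<open>Y\<close> cancels modulo 2, leaving the sign (-1)^r(Y).\<close>

lemma KL_sum_proper_dual_system:
  assumes finE: "finite E"
  shows "KL_sum_proper Q (dual_system r E) =
    (\<Sum>Y\<in>Pow E - {{}}. smult ((- 1) ^ r Y * signed_indep_count r Y)
      (monom 1 (card Y - r Y) * Q (restriction (dual_system r E) (E - Y))))"
proof -
  let ?M = "dual_system r E"
  define \<Y> where "\<Y> = {Y. Y \<subseteq> E \<and> (\<forall>e\<in>Y. r (Y - {e}) = r Y)} - {{}}"
  define t where "t Y = smult ((- 1) ^ r Y * signed_indep_count r Y)
      (monom 1 (card Y - r Y) * Q (restriction ?M (E - Y)))" for Y
  have inj: "inj_on (\<lambda>Y. E - Y) \<Y>" by (rule inj_onI) (auto simp: \<Y>_def)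
  have flats: "flats ?M - {ground ?M} = (\<lambda>Y. E - Y) ` \<Y>"
    unfolding flats_dual_system[OF finE] \<Y>_def by auto
  have "smult ((- 1) ^ (rk ?M - rank_of ?M (E - Y)) * moebius_value (contraction ?M (E - Y)))
        (monom 1 (rk ?M - rank_of ?M (E - Y)) * Q (restriction ?M (E - Y))) = t Y"
    if "Y \<in> \<Y>" for Y
  proof -
    have Y: "Y \<subseteq> E" "\<forall>e\<in>Y. r (Y - {e}) = r Y" using that by (auto simp: \<Y>_def)
    have finY: "finite Y" using Y finE finite_subset by blast
    have "E - (E - Y) = Y" using Y by auto
    then have "rank_of ?M (E - Y) + r E = card (E - Y) + r Y"
      using rank_of_dual_system[OF finE, of "E - Y"] by simp
    moreover have "rk ?M = card E - r E" by (rule rk_dual_system[OF finE])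
    moreover have "r E \<le> card E" "r Y \<le> card Y" using finE finY by (simp_all add: rank_le_card)
    moreover have "card (E - Y) = card E - card Y" "card Y \<le> card E"
      using Y finY finE by (auto simp: card_Diff_subset card_mono)
    ultimately have rk: "rk ?M - rank_of ?M (E - Y) = card Y - r Y" by linarith
    have sign: "(- 1 :: int) ^ (card Y - r Y) * (- 1) ^ (card Y - card I) = (- 1) ^ r Y * (- 1) ^ card I"
      if "I \<subseteq> Y" for I
    proof -
      have "card I \<le> card Y" using that finY by (simp add: card_mono)
      then have "even (card Y - r Y + (card Y - card I)) = even (r Y + card I)"
        using \<open>r Y \<le> card Y\<close> by auto
      then have "(- 1 :: int) ^ (card Y - r Y + (card Y - card I)) = (- 1) ^ (r Y + card I)"
        by (simp only: minus_one_power_iff)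
      then show ?thesis by (simp only: power_add)
    qed
    have "(- 1) ^ (card Y - r Y) * moebius_value (dual_system r Y) = (- 1) ^ r Y * signed_indep_count r Y"
      unfolding moebius_value_dual_system[OF finY Y(2)] signed_indep_count_def sum_distrib_left
      by (rule sum.cong[OF refl]) (simp only: mem_Collect_eq sign)
    then show ?thesis
      unfolding rk contraction_dual_system[OF finE Y(1)] t_def by simp
  qed
  then have "KL_sum_proper Q ?M = sum t \<Y>"
    unfolding KL_sum_proper_def flats sum.reindex[OF inj] by (intro sum.cong refl) (simp only: o_apply)
  also have "\<dots> = sum t (Pow E - {{}})"
  proof (rule sum.mono_neutral_left)
    show "\<forall>Y\<in>Pow E - {{}} - \<Y>. t Y = 0"
    proof
      fix Y
      assume "Y \<in> Pow E - {{}} - \<Y>"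
      then obtain e where "finite Y" "e \<in> Y" "r (Y - {e}) \<noteq> r Y"
        using finE by (auto simp: \<Y>_def intro: finite_subset)
      then show "t Y = 0" using signed_indep_count_coloop by (simp add: t_def)
    qed
  qed (use finE in \<open>auto simp: \<Y>_def\<close>)
  finally show ?thesis by (simp add: t_def)
qed

end

text \<open>Only the spanning sets of a rank function enter its dual, so \<open>r'\<close> need not
  equal the rank function of the contraction by \<open>E - F\<close>; it suffices that it detects
  the same spanning sets.\<close>

lemma restriction_dual_system:
  assumes "F \<subseteq> E"
    and "\<And>A. A \<subseteq> F \<Longrightarrow> r' A = r' F \<longleftrightarrow> r (A \<union> (E - F)) = r E"
  shows "restriction (dual_system r E) F = dual_system r' F"
proof -
  have "r (E - X) = r E \<longleftrightarrow> r' (F - X) = r' F" if "X \<subseteq> F" for X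
  proof -
    have "E - X = (F - X) \<union> (E - F)" using that assms(1) by auto
    then show ?thesis using assms(2)[of "F - X"] by auto
  qed
  then show ?thesis using assms(1) by (auto simp: restriction_def dual_system_def)
qed

section \<open>Certifying inverse Kazhdan-Lusztig polynomials by palindromicity\<close>

lemma inverse_KL_eq_KL_rec: "inverse_KL = KL_rec"
  using inverse_KL_assignment_unique[OF inverse_KL_assignment_inverse_KL] by (rule ext)

lemma inverse_KL_rk_pos:
  assumes "matroid M" "loopless M" "rk M > 0"
  shows "inverse_KL M = lower_part (rk M) (KL_sum_proper inverse_KL M)"
  unfolding inverse_KL_eq_KL_rec using assms by (rule KL_rec_rk_pos)

text \<open>Confirms a guess without extracting coefficients from the defining sum; for circuits
  with coloops its palindromicity comes from a factorization.\<close>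

lemma inverse_KL_eqI:
  assumes M: "matroid M" "loopless M"
    and "rk M = 0 \<Longrightarrow> q = 1"
    and "rk M > 0 \<Longrightarrow> 2 * degree q < rk M"
    and "palindromic (rk M) (q + KL_sum_proper inverse_KL M)"
  shows "inverse_KL M = q"
proof (cases "rk M = 0")
  case True
  then show ?thesis using assms(3) KL_rec_rk_0[OF M] by (simp add: inverse_KL_eq_KL_rec)
next
  case False
  have "degree (KL_sum_proper inverse_KL M) \<le> rk M"
    unfolding inverse_KL_eq_KL_rec using KL_rec_rk_0 _ M
    by (rule inverse_KL_assignment_degree) (simp_all add: KL_rec_rk_pos degree_lower_part)
  then show ?thesis
    using False assms(4,5) palindromic_iff_lower_part[of q "rk M" "KL_sum_proper inverse_KL M"]
      inverse_KL_rk_pos[OF M] by simp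
qed

lemma map_poly_of_int_mult:
  "map_poly (of_int :: int \<Rightarrow> 'a :: comm_ring_1) (f * g) = map_poly of_int f * map_poly of_int g"
  by (rule poly_eqI) (simp add: coeff_map_poly coeff_mult)

lemma palindromic_mult:
  assumes "palindromic r f" "palindromic s g"
  shows "palindromic (r + s) (f * g)"
  unfolding palindromic_def
proof (intro allI impI)
  fix x :: real
  assume "x \<noteq> 0"
  then have "poly (map_poly of_int f) x = x ^ r * poly (map_poly of_int f) (1 / x)"
      "poly (map_poly of_int g) x = x ^ s * poly (map_poly of_int g) (1 / x)"
    using assms unfolding palindromic_def by blast+
  then show "poly (map_poly of_int (f * g)) x = x ^ (r + s) * poly (map_poly of_int (f * g)) (1 / x)"
    unfolding map_poly_of_int_mult poly_mult power_add by (simp only: mult_ac)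
qed

lemma palindromic_linear_power: "palindromic k ([:1, 1:] ^ k)"
proof (induction k)
  case 0
  show ?case by (simp add: palindromic_iff_coeff)
next
  case (Suc k)
  have "palindromic 1 [:1, 1:]"
    by (auto simp: palindromic_iff_coeff le_Suc_eq coeff_pCons)
  from palindromic_mult[OF this Suc] show ?case by simp
qed

section \<open>Generating functions over subsets\<close>

lemma sum_Pow_monom:
  assumes "finite A"
  shows "(\<Sum>Y\<in>Pow A. monom 1 (card Y)) = ([:1, 1:] ^ card A :: 'a :: comm_semiring_1 poly)"
  using assms
proof (induction A rule: finite_induct)
  case (insert x A)
  have "Pow A \<inter> insert x ` Pow A = {}" "inj_on (insert x) (Pow A)"
    using insert by (auto simp: inj_on_def)
  moreover have "monom (1 :: 'a) (card (insert x Y)) = [:0, 1:] * monom 1 (card Y)" if "Y \<in> Pow A" for Y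
  proof -
    have "finite Y" "x \<notin> Y" using that insert by (auto intro: finite_subset)
    then show ?thesis by (simp add: monom_Suc)
  qed
  ultimately have "(\<Sum>Y\<in>Pow (insert x A). monom (1 :: 'a) (card Y)) =
      (\<Sum>Y\<in>Pow A. monom 1 (card Y)) + [:0, 1:] * (\<Sum>Y\<in>Pow A. monom 1 (card Y))"
    using insert.hyps
    by (simp add: Pow_insert sum.union_disjoint sum.reindex sum_distrib_left)
  also have "\<dots> = [:1, 1:] ^ card (insert x A)"
    using insert by (simp add: algebra_simps)
  finally show ?case .
qed simp

lemma sum_Pow_card:
  fixes f :: "nat \<Rightarrow> 'b :: semiring_1"
  assumes "finite A"
  shows "(\<Sum>Y\<in>Pow A. f (card Y)) = (\<Sum>k\<le>card A. of_nat (card A choose k) * f k)"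
proof -
  have "card ` Pow A \<subseteq> {..card A}" using assms by (auto simp: card_mono)
  then have "(\<Sum>Y\<in>Pow A. f (card Y)) = (\<Sum>k\<le>card A. \<Sum>Y\<in>{Y \<in> Pow A. card Y = k}. f (card Y))"
    using assms by (intro sum.group[symmetric]) auto
  also have "\<dots> = (\<Sum>k\<le>card A. of_nat (card {Y. Y \<subseteq> A \<and> card Y = k}) * f k)"
    by (intro sum.cong refl) simp
  finally show ?thesis using n_subsets[OF assms] by simp
qed

text \<open>The proper part of the defining sum for a circuit on \<open>p\<close> elements: a
  nonempty \<open>Y\<close> of size j + 1 has weight j, exponent j and a free restriction.\<close>

definition circuit_sum :: "nat \<Rightarrow> int poly" where
  "circuit_sum p = (\<Sum>j<p. monom (int j * int (p choose Suc j)) j)"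

lemma sum_Pow_circuit:
  assumes "finite A"
  shows "(\<Sum>Y\<in>Pow A - {{}}. monom (int (card Y) - 1) (card Y - 1)) = circuit_sum (card A)"
proof -
  \<comment> \<open>The value 0 at \<open>k = 0\<close> lets the sum include the empty set, where
    \<open>k - 1\<close> would truncate and \<open>int k - 1\<close> would be negative.\<close>
  define f where "f k = (if k = 0 then 0 else monom (int k - 1) (k - 1))" for k
  have "(\<Sum>Y\<in>Pow A - {{}}. monom (int (card Y) - 1) (card Y - 1)) = (\<Sum>Y\<in>Pow A. f (card Y))"
  proof (rule sum.mono_neutral_cong_left)
    fix Y
    assume "Y \<in> Pow A - {{}}"
    then have "finite Y" "Y \<noteq> {}" using assms by (auto intro: finite_subset)
    then have "card Y \<noteq> 0" by simp
    then show "monom (int (card Y) - 1) (card Y - 1) = f (card Y)" by (simp add: f_def)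
  qed (use assms in \<open>auto simp: f_def\<close>)
  also have "\<dots> = (\<Sum>k\<le>card A. of_nat (card A choose k) * f k)"
    by (rule sum_Pow_card[OF assms])
  also have "\<dots> = (\<Sum>k<Suc (card A). of_nat (card A choose k) * f k)"
    by (simp add: lessThan_Suc_atMost)
  also have "\<dots> = (\<Sum>k<card A. of_nat (card A choose Suc k) * monom (int k) k)"
    unfolding sum.lessThan_Suc_shift by (simp add: f_def)
  also have "\<dots> = circuit_sum (card A)"
    unfolding circuit_sum_def
    by (intro sum.cong) (simp_all add: of_nat_poly smult_monom mult.commute)
  finally show ?thesis .
qed

section \<open>Circuits with coloops\<close>

text \<open>The rank of a circuit on \<open>m\<close> elements is m - 1. The value at
  \<open>m = 0\<close> covers free matroids; size 1 would be a loop and is excluded below.\<close>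

definition circuit_KL :: "nat \<Rightarrow> int poly" where
  "circuit_KL m = (if m = 0 then 1 else lower_part (m - 1) (circuit_sum m))"

lemma palindromic_circuit:
  assumes "m \<noteq> 1"
  shows "palindromic (m - 1) (circuit_KL m + circuit_sum m)"
proof (cases "m = 0")
  case True
  then show ?thesis by (simp add: circuit_KL_def circuit_sum_def palindromic_iff_coeff)
next
  case False
  have "degree (circuit_sum m) \<le> m - 1"
    unfolding circuit_sum_def
  proof (rule degree_sum_le)
    fix j
    assume "j \<in> {..<m}"
    then show "degree (monom (int j * int (m choose Suc j)) j) \<le> m - 1"
      using degree_monom_le[of "int j * int (m choose Suc j)" j] by simp
  qed simp
  moreover have "2 * degree (lower_part (m - 1) (circuit_sum m)) < m - 1"
    using False assms by (intro degree_lower_part) simp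
  ultimately show ?thesis using False palindromic_iff_lower_part by (simp add: circuit_KL_def)
qed

text \<open>The rank function of a single parallel class \<open>C\<close> with all other elements
  loops. \<open>C = {}\<close> gives rank zero, whose dual is free.\<close>

definition meet_rank :: "'a set \<Rightarrow> 'a set \<Rightarrow> nat" where
  "meet_rank C A = of_bool (A \<inter> C \<noteq> {})"

lemma rank_function_meet_rank: "rank_function (meet_rank C)"
proof
  fix A B :: "'a set"
  show "meet_rank C (A \<union> B) + meet_rank C (A \<inter> B) \<le> meet_rank C A + meet_rank C B"
    by (cases "A \<inter> C = {}"; cases "B \<inter> C = {}") (auto simp: meet_rank_def of_bool_def)
qed (auto simp: meet_rank_def of_bool_def)

text \<open>The independent sets are the empty set and the singletons inside
  \<open>C\<close>.\<close>

lemma signed_indep_count_meet_rank: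
  assumes "finite Y"
  shows "signed_indep_count (meet_rank C) Y = 1 - int (card (Y \<inter> C))"
proof -
  have "{I. I \<subseteq> Y \<and> meet_rank C I = card I} = insert {} ((\<lambda>e. {e}) ` (Y \<inter> C))"
  proof (intro equalityI subsetI)
    fix I
    assume I: "I \<in> {I. I \<subseteq> Y \<and> meet_rank C I = card I}"
    then have "finite I" using assms by (auto intro: finite_subset)
    show "I \<in> insert {} ((\<lambda>e. {e}) ` (Y \<inter> C))"
    proof (cases "I = {}")
      case False
      then have "card I \<noteq> 0" using \<open>finite I\<close> by simp
      then have "card I = 1" "I \<inter> C \<noteq> {}" using I by (auto simp: meet_rank_def of_bool_def split: if_splits)
      then show ?thesis using I by (auto simp: card_1_singleton_iff)
    qed simp
  qed (auto simp: meet_rank_def)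
  moreover have "inj_on (\<lambda>e. {e}) (Y \<inter> C)" by simp
  moreover have "{} \<notin> (\<lambda>e. {e}) ` (Y \<inter> C)" by auto
  ultimately show ?thesis
    using assms by (simp add: signed_indep_count_def sum.reindex)
qed

text \<open>The dual of \<open>meet_rank C\<close> on \<open>E\<close> is a circuit on \<open>C\<close> together with the coloops \<open>E - C\<close>.\<close>

theorem inverse_KL_circuit:
  assumes "finite E" "C \<subseteq> E" "card C \<noteq> 1"
  shows "inverse_KL (dual_system (meet_rank C) E) = circuit_KL (card C)"
  using assms
proof (induction "card E" arbitrary: E C rule: less_induct)
  case less
  interpret rank_function "meet_rank C" by (rule rank_function_meet_rank)
  note finE = \<open>finite E\<close>
  have finC: "finite C" using less.prems finite_subset by blast
  let ?M = "dual_system (meet_rank C) E"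
  let ?q = "circuit_KL (card C)"
  \<comment> \<open>At \<open>{}\<close> this is the guess \<open>?q\<close>, the term of the full
    ground set, so the sum over all of \<open>Pow E\<close> is \<open>?q\<close> plus the proper
    part.\<close>
  define t where "t Y = (if Y \<inter> C = {} then monom 1 (card Y) * ?q
      else monom (int (card (Y \<inter> C)) - 1) (card Y - 1))" for Y
  have rE: "meet_rank C E = (if C = {} then 0 else 1)"
    using less.prems by (auto simp: meet_rank_def)
  have rk: "rk ?M = card E - (if C = {} then 0 else 1)"
    using rk_dual_system[OF finE] rE by simp
  have card_C: "C \<noteq> {} \<Longrightarrow> 2 \<le> card C" "card C \<le> card E"
  proof -
    assume "C \<noteq> {}"
    then have "card C \<noteq> 0" using finC by simp
    then show "2 \<le> card C" using less.prems(3) by simp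
  qed (use finE less.prems(2) in \<open>simp add: card_mono\<close>)
  have "\<forall>e\<in>E. meet_rank C (E - {e}) = meet_rank C E"
  proof
    fix e
    assume "e \<in> E"
    have "(E - {e}) \<inter> C = {} \<longleftrightarrow> C \<subseteq> {e}" using less.prems by auto
    also have "\<dots> \<longleftrightarrow> C = {}" using less.prems(3) by (auto simp: subset_singleton_iff)
    finally show "meet_rank C (E - {e}) = meet_rank C E"
      using less.prems(2) by (auto simp: meet_rank_def)
  qed
  then have loopless: "loopless ?M" by (simp add: loopless_dual_system[OF finE])
  have "smult ((- 1) ^ meet_rank C Y * signed_indep_count (meet_rank C) Y)
      (monom 1 (card Y - meet_rank C Y) * inverse_KL (restriction ?M (E - Y))) = t Y"
    if "Y \<in> Pow E - {{}}" for Y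
  proof -
    have Y: "Y \<subseteq> E" "Y \<noteq> {}" "finite Y" using that finE by (auto intro: finite_subset)
    have less_card: "card (E - Y) < card E"
      using Y finE by (intro psubset_card_mono) auto
    have Y': "E - (E - Y) = Y" using Y by auto
    \<comment> \<open>Contracting by a \<open>Y\<close> that misses \<open>C\<close> leaves the same
      circuit with fewer coloops. A \<open>Y\<close> meeting \<open>C\<close> uses up the rank, so
      the restriction is free, which is the induction hypothesis for an empty circuit.\<close>
    show ?thesis
    proof (cases "Y \<inter> C = {}")
      case True
      then have "meet_rank C (A \<union> (E - (E - Y))) = meet_rank C A" for A
        unfolding Y' by (auto simp: meet_rank_def)
      moreover have "meet_rank C (E - Y) = meet_rank C E"
        using True less.prems(2) unfolding meet_rank_def by (intro arg_cong[of _ _ of_bool]) auto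
      ultimately have "restriction ?M (E - Y) = dual_system (meet_rank C) (E - Y)"
        by (intro restriction_dual_system) auto
      moreover have "inverse_KL (dual_system (meet_rank C) (E - Y)) = ?q"
        using True less.prems less_card by (intro less.hyps) auto
      moreover have "meet_rank C Y = 0" using True by (simp add: meet_rank_def)
      ultimately show ?thesis
        using True Y by (simp add: t_def signed_indep_count_meet_rank)
    next
      case False
      have "meet_rank C (A \<union> (E - (E - Y))) = meet_rank C E" for A
        using False less.prems(2) unfolding Y' by (auto simp: meet_rank_def)
      then have "restriction ?M (E - Y) = dual_system (meet_rank {}) (E - Y)"
        by (intro restriction_dual_system) (auto simp: meet_rank_def)
      moreover have "inverse_KL (dual_system (meet_rank {}) (E - Y)) = circuit_KL (card ({} :: 'a set))"
        using finE less_card by (intro less.hyps) auto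
      moreover have "meet_rank C Y = 1" using False by (simp add: meet_rank_def)
      ultimately show ?thesis
        using False Y by (simp add: t_def signed_indep_count_meet_rank circuit_KL_def smult_monom)
    qed
  qed
  then have "KL_sum_proper inverse_KL ?M = sum t (Pow E - {{}})"
    unfolding KL_sum_proper_dual_system[OF finE] by (rule sum.cong[OF refl])
  moreover have "sum t (Pow E) = t {} + sum t (Pow E - {{}})"
    using finE by (intro sum.remove) auto
  moreover have "t {} = ?q" by (simp add: t_def)
  \<comment> \<open>A subset of \<open>E\<close> is an independent choice in \<open>E - C\<close>
    and in \<open>C\<close>. The coloops split off a power of 1 + x, which is palindromic, and
    therefore leave the polynomial unchanged.\<close>
  moreover have "sum t (Pow E) = [:1, 1:] ^ card (E - C) * (?q + circuit_sum (card C))"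
  proof -
    define h where "h Y = (if Y = {} then ?q else monom (int (card Y) - 1) (card Y - 1))" for Y :: "'a set"
    have "sum t (Pow E) = (\<Sum>(Z, Y)\<in>Pow (E - C) \<times> Pow C. monom 1 (card Z) * h Y)"
    proof (rule sum.reindex_bij_witness[of _ "\<lambda>(Z, Y). Z \<union> Y" "\<lambda>Y. (Y - C, Y \<inter> C)"])
      fix Y
      assume "Y \<in> Pow E"
      then have finY: "finite Y" using finE by (auto intro: finite_subset)
      have card: "card Y = card (Y - C) + card (Y \<inter> C)"
        using card_Int_Diff[OF finY, of C] by simp
      show "(case (Y - C, Y \<inter> C) of (Z, Y) \<Rightarrow> monom 1 (card Z) * h Y) = t Y"
      proof (cases "Y \<inter> C = {}")
        case False
        then have "card (Y \<inter> C) \<noteq> 0" using finY by simp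
        then have "card Y - 1 = card (Y - C) + (card (Y \<inter> C) - 1)" using card by simp
        then show ?thesis using False by (simp add: t_def h_def mult_monom)
      qed (simp add: t_def h_def card)
    qed (use less.prems(2) in auto)
    also have "\<dots> = (\<Sum>Z\<in>Pow (E - C). monom 1 (card Z)) * sum h (Pow C)"
      by (simp add: sum_product sum.cartesian_product)
    also have "sum h (Pow C) = h {} + sum h (Pow C - {{}})"
      using finC by (intro sum.remove) auto
    also have "sum h (Pow C - {{}}) = circuit_sum (card C)"
      unfolding sum_Pow_circuit[OF finC, symmetric] by (intro sum.cong) (auto simp: h_def)
    finally show ?thesis using finE by (simp add: sum_Pow_monom h_def)
  qed
  ultimately have total: "?q + KL_sum_proper inverse_KL ?M =
      [:1, 1:] ^ card (E - C) * (?q + circuit_sum (card C))"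
    by simp
  have "palindromic (card (E - C) + (card C - 1)) (?q + KL_sum_proper inverse_KL ?M)"
    unfolding total using less.prems(3)
    by (intro palindromic_mult palindromic_linear_power palindromic_circuit)
  moreover have "card (E - C) + (card C - 1) = rk ?M"
  proof (cases "C = {}")
    case True
    then show ?thesis unfolding rk by simp
  next
    case False
    then show ?thesis
      unfolding rk using card_C(1)[OF False] card_C(2) finC less.prems(2)
      by (simp add: card_Diff_subset)
  qed
  ultimately have pal: "palindromic (rk ?M) (?q + KL_sum_proper inverse_KL ?M)" by simp
  have deg: "2 * degree ?q < rk ?M" if "rk ?M > 0"
  proof (cases "C = {}")
    case False
    then have "2 * degree ?q < card C - 1"
      using card_C(1) by (auto simp: circuit_KL_def intro!: degree_lower_part)
    also have "\<dots> \<le> rk ?M" using card_C(2) False unfolding rk by simp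
    finally show ?thesis .
  qed (use that in \<open>simp add: circuit_KL_def\<close>)
  show ?case
  proof (rule inverse_KL_eqI[OF matroid_dual_system[OF finE] loopless _ deg pal])
    assume "rk ?M = 0"
    then have "C = {}" unfolding rk using card_C by (cases "C = {}") auto
    then show "?q = 1" by (simp add: circuit_KL_def)
  qed
qed

section \<open>Duals of rank two matroids\<close>

definition class_rank :: "('a \<Rightarrow> 'b) \<Rightarrow> 'a set \<Rightarrow> nat" where
  "class_rank c A = min 2 (card (c ` A))"

text \<open>Truncation at 2 preserves submodularity because the number of classes met by the
  intersection is at most either of the two numbers.\<close>

lemma rank_function_class_rank: "rank_function (class_rank c)"
proof
  fix A B :: "'a set"
  assume fin: "finite A" "finite B"
  have "card (c ` (A \<inter> B)) \<le> card (c ` A \<inter> c ` B)" using fin by (intro card_mono) auto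
  moreover have "card (c ` A \<union> c ` B) + card (c ` A \<inter> c ` B) = card (c ` A) + card (c ` B)"
    using fin by (intro card_Un_Int[symmetric]) auto
  moreover have "card (c ` A \<inter> c ` B) \<le> card (c ` A)" "card (c ` A \<inter> c ` B) \<le> card (c ` B)"
    using fin by (auto intro!: card_mono)
  ultimately show "class_rank c (A \<union> B) + class_rank c (A \<inter> B) \<le> class_rank c A + class_rank c B"
    unfolding class_rank_def image_Un by linarith
next
  fix A B :: "'a set"
  assume "finite B" "A \<subseteq> B"
  then have "card (c ` A) \<le> card (c ` B)" by (intro card_mono image_mono) auto
  then show "class_rank c A \<le> class_rank c B" by (simp add: class_rank_def)
next
  fix A :: "'a set" and e
  assume "finite A"
  then have "card (c ` insert e A) \<le> Suc (card (c ` A))" by (simp add: card_insert_if)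
  then show "class_rank c (insert e A) \<le> Suc (class_rank c A)" by (simp add: class_rank_def)
qed (simp add: class_rank_def)

text \<open>Exchange the two sums: the supersets \<open>Y\<close> of a fixed independent
  \<open>I\<close> contribute x^|I| (1 + x)^(|E| - |I|).\<close>

lemma sum_signed_indep_count:
  assumes "finite E"
  shows "(\<Sum>Y\<in>Pow E. monom (signed_indep_count r Y) (card Y)) =
    (\<Sum>I | I \<subseteq> E \<and> r I = card I. monom ((- 1) ^ card I) (card I) * [:1, 1:] ^ (card E - card I))"
proof -
  define \<I> where "\<I> = {I. I \<subseteq> E \<and> r I = card I}"
  have "(\<Sum>Y\<in>Pow E. monom (signed_indep_count r Y) (card Y)) =
      (\<Sum>Y\<in>Pow E. \<Sum>I\<in>{I \<in> \<I>. I \<subseteq> Y}. monom ((- 1) ^ card I) (card Y))"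
  proof (rule sum.cong[OF refl])
    fix Y
    assume "Y \<in> Pow E"
    then have "{I. I \<subseteq> Y \<and> r I = card I} = {I \<in> \<I>. I \<subseteq> Y}" by (auto simp: \<I>_def)
    then show "monom (signed_indep_count r Y) (card Y) =
        (\<Sum>I\<in>{I \<in> \<I>. I \<subseteq> Y}. monom ((- 1) ^ card I) (card Y))"
      by (simp add: signed_indep_count_def monom_sum)
  qed
  also have "\<dots> = (\<Sum>I\<in>\<I>. \<Sum>Y\<in>{Y \<in> Pow E. I \<subseteq> Y}. monom ((- 1) ^ card I) (card Y))"
    using assms by (intro sum.swap_restrict) (auto simp: \<I>_def)
  also have "\<dots> = (\<Sum>I\<in>\<I>. monom ((- 1) ^ card I) (card I) * [:1, 1:] ^ (card E - card I))"
  proof (rule sum.cong[OF refl])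
    fix I
    assume "I \<in> \<I>"
    then have I: "I \<subseteq> E" "finite I" using assms by (auto simp: \<I>_def intro: finite_subset)
    have "(\<Sum>Y\<in>{Y \<in> Pow E. I \<subseteq> Y}. monom ((- 1) ^ card I) (card Y)) =
        (\<Sum>Z\<in>Pow (E - I). monom ((- 1 :: int) ^ card I) (card I) * monom 1 (card Z))"
    proof (rule sum.reindex_bij_witness[of _ "\<lambda>Z. I \<union> Z" "\<lambda>Y. Y - I"])
      fix Y
      assume "Y \<in> {Y \<in> Pow E. I \<subseteq> Y}"
      then have Y: "I \<subseteq> Y" "finite Y" using assms by (auto intro: finite_subset)
      then have "card Y = card I + card (Y - I)"
        using I(2) by (metis card_Diff_subset card_mono le_add_diff_inverse)
      then show "monom ((- 1 :: int) ^ card I) (card I) * monom 1 (card (Y - I)) =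
          monom ((- 1) ^ card I) (card Y)"
        by (simp add: mult_monom)
    qed (use I in auto)
    also have "\<dots> = monom ((- 1) ^ card I) (card I) * [:1, 1:] ^ (card E - card I)"
      using assms I by (simp add: sum_Pow_monom card_Diff_subset flip: sum_distrib_left)
    finally show "(\<Sum>Y\<in>{Y \<in> Pow E. I \<subseteq> Y}. monom ((- 1) ^ card I) (card Y)) =
        monom ((- 1 :: int) ^ card I) (card I) * [:1, 1:] ^ (card E - card I)" .
  qed
  finally show ?thesis by (simp add: \<I>_def)
qed

definition split_pairs :: "('a \<Rightarrow> 'b) \<Rightarrow> 'a set \<Rightarrow> 'a set set" where
  "split_pairs c E = {I. I \<subseteq> E \<and> card I = 2 \<and> card (c ` I) = 2}"

lemma sum_indep_class_rank:
  fixes f :: "nat \<Rightarrow> 'c :: semiring_1"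
  assumes "finite E"
  shows "(\<Sum>I | I \<subseteq> E \<and> class_rank c I = card I. f (card I)) =
    f 0 + of_nat (card E) * f 1 + of_nat (card (split_pairs c E)) * f 2"
proof -
  define \<I> where "\<I> = {I. I \<subseteq> E \<and> class_rank c I = card I}"
  have "card ` \<I> \<subseteq> {..2}"
  proof
    fix k
    assume "k \<in> card ` \<I>"
    then obtain I where "class_rank c I = k" by (auto simp: \<I>_def)
    then show "k \<in> {..2}" by (auto simp: class_rank_def)
  qed
  then have "(\<Sum>I\<in>\<I>. f (card I)) = (\<Sum>k\<le>2. \<Sum>I\<in>{I \<in> \<I>. card I = k}. f (card I))"
    using assms by (intro sum.group[symmetric]) (auto simp: \<I>_def)
  also have "\<dots> = (\<Sum>k\<le>2. of_nat (card {I \<in> \<I>. card I = k}) * f k)"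
    by (intro sum.cong refl) simp
  also have "\<dots> = of_nat (card {I \<in> \<I>. card I = 0}) * f 0 +
      of_nat (card {I \<in> \<I>. card I = 1}) * f 1 + of_nat (card {I \<in> \<I>. card I = 2}) * f 2"
    by (simp add: numeral_2_eq_2)
  also have "{I \<in> \<I>. card I = 0} = {{}}"
    using finite_subset[OF _ assms] by (auto simp: \<I>_def class_rank_def card_eq_0_iff)
  also have "{I \<in> \<I>. card I = 1} = {I. I \<subseteq> E \<and> card I = 1}"
    by (auto simp: \<I>_def class_rank_def card_1_singleton_iff)
  also have "{I \<in> \<I>. card I = 2} = split_pairs c E"
  proof -
    have "min 2 (card (c ` I)) = 2 \<longleftrightarrow> card (c ` I) = 2" if "card I = 2" for I
    proof -
      have "finite I" using that card.infinite by fastforce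
      then have "card (c ` I) \<le> 2" using card_image_le[of I c] that by simp
      then show ?thesis by linarith
    qed
    then show ?thesis by (auto simp: \<I>_def split_pairs_def class_rank_def)
  qed
  finally show ?thesis using n_subsets[OF assms, of 1] by (simp add: \<I>_def)
qed

text \<open>Every pair is split or lies in one class; the additive form avoids subtraction on
  naturals.\<close>

lemma card_split_pairs:
  assumes "finite E"
  shows "card (split_pairs c E) + (\<Sum>i\<in>c ` E. card {e \<in> E. c e = i} choose 2) = card E choose 2"
proof -
  define D where "D i = {I. I \<subseteq> {e \<in> E. c e = i} \<and> card I = 2}" for i
  have fin: "finite (split_pairs c E)" "finite (D i)" for i
    using assms by (auto simp: split_pairs_def D_def)
  have "{I. I \<subseteq> E \<and> card I = 2} = split_pairs c E \<union> (\<Union>i\<in>c ` E. D i)"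
  proof (intro equalityI subsetI)
    fix I
    assume "I \<in> {I. I \<subseteq> E \<and> card I = 2}"
    then obtain a b where I: "I = {a, b}" "a \<noteq> b" "a \<in> E" "b \<in> E"
      by (auto simp: card_2_iff)
    show "I \<in> split_pairs c E \<union> (\<Union>i\<in>c ` E. D i)"
    proof (cases "c a = c b")
      case True
      then have "I \<in> D (c a)" using I by (auto simp: D_def)
      then show ?thesis using I by blast
    next
      case False
      then show ?thesis using I by (auto simp: split_pairs_def)
    qed
  qed (auto simp: split_pairs_def D_def)
  moreover have "split_pairs c E \<inter> (\<Union>i\<in>c ` E. D i) = {}"
  proof -
    have "I \<notin> split_pairs c E" if I: "I \<in> D i" for I i
    proof
      assume "I \<in> split_pairs c E"
      moreover have "c ` I \<subseteq> {i}" using I by (auto simp: D_def)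
      then have "card (c ` I) \<le> card {i}" by (intro card_mono) auto
      ultimately show False by (simp add: split_pairs_def)
    qed
    then show ?thesis by blast
  qed
  moreover have "card (\<Union>i\<in>c ` E. D i) = (\<Sum>i\<in>c ` E. card (D i))"
  proof (rule card_UN_disjoint)
    show "\<forall>i\<in>c ` E. \<forall>j\<in>c ` E. i \<noteq> j \<longrightarrow> D i \<inter> D j = {}"
    proof (intro ballI impI equals0I)
      fix i j I
      assume "i \<noteq> j" "I \<in> D i \<inter> D j"
      then have "I = {}" "card I = 2" by (auto simp: D_def)
      then show False by simp
    qed
  qed (use assms fin in auto)
  ultimately have "card {I. I \<subseteq> E \<and> card I = 2} =
      card (split_pairs c E) + (\<Sum>i\<in>c ` E. card (D i))"
    using assms fin by (simp add: card_Un_disjoint)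
  then show ?thesis using assms by (simp add: n_subsets D_def)
qed

text \<open>The factor x^2 clears x^(|Y| - r(Y)): a \<open>Y\<close> of rank two then contributes
  exactly its term \<open>a Y\<close> of the first sum. A nonempty \<open>Y\<close> inside a class
  has rank one, weight 1 - |Y| and a circuit as restriction; \<open>h\<close> is the difference from
  \<open>a Y\<close>. The -1 removes the empty set. \<open>ne1\<close> excludes circuits of size
  1.\<close>

theorem KL_sum_proper_class_rank:
  fixes c :: "'a \<Rightarrow> 'b"
  assumes finE: "finite E" and two: "2 \<le> card (c ` E)"
    and ne1: "\<And>i. i \<in> c ` E \<Longrightarrow> card {e \<in> E. c e \<noteq> i} \<noteq> 1"
  shows "monom 1 2 * KL_sum_proper inverse_KL (dual_system (class_rank c) E) =
    (\<Sum>Y\<in>Pow E. monom (signed_indep_count (class_rank c) Y) (card Y)) - 1 +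
    (\<Sum>i\<in>c ` E. circuit_sum (card {e \<in> E. c e = i}) *
      (monom 1 1 + monom 1 2 * circuit_KL (card {e \<in> E. c e \<noteq> i})))"
proof -
  interpret rank_function "class_rank c" by (rule rank_function_class_rank)
  let ?M = "dual_system (class_rank c) E"
  let ?w = "signed_indep_count (class_rank c)"
  define P where "P i = {e \<in> E. c e = i}" for i
  define C where "C i = {e \<in> E. c e \<noteq> i}" for i
  define a where "a Y = monom (?w Y) (card Y)" for Y
  define h where "h i Y = monom (int (card Y) - 1) (card Y - 1) *
      (monom 1 1 + monom 1 2 * circuit_KL (card (C i)))" for i and Y :: "'a set"
  define T where "T Y = smult ((- 1) ^ class_rank c Y * ?w Y)
      (monom 1 (card Y - class_rank c Y) * inverse_KL (restriction ?M (E - Y)))" for Y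
  have rE: "class_rank c E = 2" using two by (simp add: class_rank_def)
  have rank1: "monom 1 2 * T Y = a Y + h i Y" if Y: "Y \<in> Pow (P i) - {{}}" and i: "i \<in> c ` E" for Y i
  proof -
    have Y': "Y \<subseteq> E" "Y \<noteq> {}" "finite Y" "c ` Y = {i}" "E - (E - Y) = Y"
      using Y finE by (auto simp: P_def intro: finite_subset)
    have C_ne: "C i \<noteq> {}"
    proof
      assume "C i = {}"
      then have "c ` E \<subseteq> {i}" by (auto simp: C_def)
      then have "card (c ` E) \<le> card {i}" by (intro card_mono) auto
      then show False using two by simp
    qed
    \<comment> \<open>Contraction by \<open>Y\<close> turns the rest of class \<open>i\<close> into
      loops and merges all other classes into one parallel class \<open>C i\<close>.\<close>
    have "restriction ?M (E - Y) = dual_system (meet_rank (C i)) (E - Y)"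
    proof (rule restriction_dual_system)
      fix A
      assume A: "A \<subseteq> E - Y"
      have "C i \<subseteq> E - Y" using Y by (auto simp: C_def P_def)
      then have "meet_rank (C i) (E - Y) = 1" using C_ne by (auto simp: meet_rank_def)
      moreover have "class_rank c (A \<union> Y) = 2 \<longleftrightarrow> A \<inter> C i \<noteq> {}"
      proof
        assume "A \<inter> C i \<noteq> {}"
        then obtain e where "e \<in> A" "c e \<noteq> i" by (auto simp: C_def)
        moreover have "{i, c e} \<subseteq> c ` (A \<union> Y)" using \<open>e \<in> A\<close> Y'(4) by auto
        then have "card {i, c e} \<le> card (c ` (A \<union> Y))"
          using A finE Y'(3) by (intro card_mono) (auto intro: finite_subset)
        ultimately show "class_rank c (A \<union> Y) = 2" by (simp add: class_rank_def)
      next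
        assume r2: "class_rank c (A \<union> Y) = 2"
        show "A \<inter> C i \<noteq> {}"
        proof
          assume "A \<inter> C i = {}"
          then have "c ` (A \<union> Y) \<subseteq> {i}" using A Y'(4) by (auto simp: C_def)
          then have "card (c ` (A \<union> Y)) \<le> card {i}" by (intro card_mono) auto
          then show False using r2 by (simp add: class_rank_def)
        qed
      qed
      ultimately show "meet_rank (C i) A = meet_rank (C i) (E - Y) \<longleftrightarrow>
          class_rank c (A \<union> (E - (E - Y))) = class_rank c E"
        unfolding rE Y'(5) by (simp add: meet_rank_def)
    qed auto
    moreover have "inverse_KL (dual_system (meet_rank (C i)) (E - Y)) = circuit_KL (card (C i))"
      using finE Y ne1[OF i] by (intro inverse_KL_circuit) (auto simp: C_def P_def)
    moreover have "class_rank c Y = 1" using Y'(4) by (simp add: class_rank_def)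
    moreover have w: "?w Y = 1 - int (card Y)"
    proof -
      have "class_rank c I = meet_rank UNIV I" if "I \<subseteq> Y" for I
      proof (cases "I = {}")
        case False
        then have "c ` I = {i}"
          using image_mono[OF that, of c] Y'(4) by (metis image_is_empty subset_singletonD)
        then show ?thesis using False by (simp add: class_rank_def meet_rank_def)
      qed (simp add: class_rank_def meet_rank_def)
      then have "?w Y = signed_indep_count (meet_rank UNIV) Y"
        unfolding signed_indep_count_def by (intro sum.cong) auto
      then show ?thesis using Y'(3) by (simp add: signed_indep_count_meet_rank)
    qed
    ultimately have "T Y = monom (int (card Y) - 1) (card Y - 1) * circuit_KL (card (C i))"
      by (simp add: T_def smult_monom flip: mult_smult_left)
    moreover have "a Y + monom (int (card Y) - 1) (card Y - 1) * monom 1 1 = 0"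
    proof -
      have "card Y \<noteq> 0" using Y' by simp
      then have "card Y - 1 + 1 = card Y" by simp
      then show ?thesis by (simp add: a_def w mult_monom add_monom)
    qed
    ultimately show ?thesis by (simp add: h_def algebra_simps)
  qed
  have rank2: "monom 1 2 * T Y = a Y" if Y: "Y \<subseteq> E" and r2: "class_rank c Y = 2" for Y
  proof -
    have Y': "finite Y" "E - (E - Y) = Y" using Y finE by (auto intro: finite_subset)
    have "restriction ?M (E - Y) = dual_system (meet_rank {}) (E - Y)"
    proof (rule restriction_dual_system)
      fix A
      assume "A \<subseteq> E - Y"
      then have "class_rank c Y \<le> class_rank c (A \<union> Y)"
        using Y' finE by (intro rank_mono) (auto intro: finite_subset)
      moreover have "class_rank c (A \<union> Y) \<le> 2" by (simp add: class_rank_def)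
      ultimately have "class_rank c (A \<union> Y) = 2" using r2 by simp
      then show "meet_rank {} A = meet_rank {} (E - Y) \<longleftrightarrow>
          class_rank c (A \<union> (E - (E - Y))) = class_rank c E"
        unfolding rE Y'(2) by (simp add: meet_rank_def)
    qed auto
    moreover have "inverse_KL (dual_system (meet_rank {}) (E - Y)) = circuit_KL (card ({} :: 'a set))"
      using finE by (intro inverse_KL_circuit) auto
    moreover have "Suc (Suc (card Y - 2)) = card Y" using rank_le_card[OF Y'(1)] r2 by simp
    ultimately show ?thesis
      by (simp add: T_def a_def r2 circuit_KL_def smult_monom mult_monom)
  qed
  have fin: "finite (P i)" for i using finE by (simp add: P_def)
  define U where "U = (\<Union>i\<in>c ` E. Pow (P i) - {{}})"
  have U: "U \<subseteq> Pow E - {{}}" by (auto simp: U_def P_def)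
  have dis: "(Pow (P i) - {{}}) \<inter> (Pow (P j) - {{}}) = {}" if "i \<noteq> j" for i j
    using that by (auto simp: P_def)
  have sumU: "sum g U = (\<Sum>i\<in>c ` E. sum g (Pow (P i) - {{}}))" for g :: "'a set \<Rightarrow> int poly"
    unfolding U_def using finE fin dis by (intro sum.UNION_disjoint) auto
  have "class_rank c Y = 2" if YU: "Y \<in> Pow E - {{}} - U" for Y
  proof -
    obtain e where e: "e \<in> Y" "e \<in> E" using YU by auto
    have "Y \<notin> Pow (P (c e)) - {{}}" using YU e(2) by (auto simp: U_def)
    then obtain d where d: "d \<in> Y" "c d \<noteq> c e" using YU by (auto simp: P_def)
    have "{c d, c e} \<subseteq> c ` Y" using d e by auto
    then have "card {c d, c e} \<le> card (c ` Y)"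
      using YU finE by (intro card_mono) (auto intro: finite_subset)
    then show ?thesis using d by (simp add: class_rank_def)
  qed
  then have "(\<Sum>Y\<in>Pow E - {{}} - U. monom 1 2 * T Y) = sum a (Pow E - {{}} - U)"
    using rank2 by (intro sum.cong) auto
  moreover have "(\<Sum>Y\<in>U. monom 1 2 * T Y) = sum a U + (\<Sum>i\<in>c ` E. sum (h i) (Pow (P i) - {{}}))"
    unfolding sumU sum.distrib[symmetric] using rank1 by (intro sum.cong refl) simp
  moreover have "(\<Sum>Y\<in>Pow E - {{}}. monom 1 2 * T Y) =
      (\<Sum>Y\<in>Pow E - {{}} - U. monom 1 2 * T Y) + (\<Sum>Y\<in>U. monom 1 2 * T Y)"
    using finE U by (intro sum.subset_diff) auto
  moreover have "sum a (Pow E - {{}}) = sum a (Pow E - {{}} - U) + sum a U"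
    using finE U by (intro sum.subset_diff) auto
  moreover have "sum a (Pow E) = a {} + sum a (Pow E - {{}})"
    using finE by (intro sum.remove) auto
  moreover have "a {} = 1"
  proof -
    have "{I. I = {} \<and> class_rank c I = card I} = {{} :: 'a set}" by (auto simp: class_rank_def)
    then show ?thesis by (simp add: a_def signed_indep_count_def)
  qed
  moreover have "sum (h i) (Pow (P i) - {{}}) = circuit_sum (card (P i)) *
      (monom 1 1 + monom 1 2 * circuit_KL (card (C i)))" for i
    unfolding h_def sum_distrib_right[symmetric] sum_Pow_circuit[OF fin] ..
  ultimately have "(\<Sum>Y\<in>Pow E - {{}}. monom 1 2 * T Y) = sum a (Pow E) - 1 +
      (\<Sum>i\<in>c ` E. circuit_sum (card (P i)) * (monom 1 1 + monom 1 2 * circuit_KL (card (C i))))"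
    by simp
  then show ?thesis
    unfolding KL_sum_proper_dual_system[OF finE] sum_distrib_left T_def a_def P_def C_def .
qed

section \<open>The Laguerre inequality\<close>

lemma map_poly_of_real_mult:
  "map_poly (of_real :: real \<Rightarrow> 'a :: {comm_ring_1, real_algebra_1}) (f * g) =
    map_poly of_real f * map_poly of_real g"
  by (rule poly_eqI) (simp add: coeff_map_poly coeff_mult)

lemma poly_map_poly_of_real:
  "poly (map_poly (of_real :: real \<Rightarrow> 'a :: {comm_ring_1, real_algebra_1}) p) (of_real x) = of_real (poly p x)"
  by (induction p) (simp_all add: map_poly_pCons)

text \<open>Induction on the degree, splitting off a real root: for p = (x - a) q one has p'^2 - p
  p'' = q^2 + (x - a)^2 (q'^2 - q q'').\<close>

theorem real_rooted_imp_laguerre: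
  assumes "real_rooted p"
  shows "poly p x * poly (pderiv (pderiv p)) x \<le> (poly (pderiv p) x)\<^sup>2"
  using assms
proof (induction "degree p" arbitrary: p)
  case 0
  then have "pderiv p = 0" by (simp add: pderiv_eq_0_iff)
  then show ?case by simp
next
  case (Suc n)
  let ?c = "map_poly complex_of_real"
  have "degree (?c p) \<noteq> 0" using Suc.hyps(2) by (simp add: degree_map_poly)
  then have "\<not> constant (poly (?c p))" by (simp add: constant_degree)
  then obtain z where z: "poly (?c p) z = 0" using fundamental_theorem_of_algebra by blast
  then have "z \<in> \<real>" using Suc.prems by (simp add: real_rooted_def)
  then obtain a where "z = complex_of_real a" by (elim Reals_cases)
  then have "poly p a = 0" using z by (simp add: poly_map_poly_of_real)
  then obtain q where p: "p = [:- a, 1:] * q" by (auto simp: poly_eq_0_iff_dvd elim: dvdE)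
  have "q \<noteq> 0" using Suc.hyps(2) p by auto
  then have "degree p = Suc (degree q)" unfolding p by (subst degree_mult_eq) auto
  moreover have "real_rooted q"
    using Suc.prems unfolding real_rooted_def p map_poly_of_real_mult by simp
  ultimately have "poly q x * poly (pderiv (pderiv q)) x \<le> (poly (pderiv q) x)\<^sup>2"
    using Suc.hyps by simp
  then have "0 \<le> (poly q x)\<^sup>2 + (x - a)\<^sup>2 * ((poly (pderiv q) x)\<^sup>2 - poly q x * poly (pderiv (pderiv q)) x)"
    by simp
  also have "\<dots> = (poly (pderiv p) x)\<^sup>2 - poly p x * poly (pderiv (pderiv p)) x"
  proof -
    have p': "pderiv p = q + [:- a, 1:] * pderiv q"
      by (simp add: p pderiv_mult pderiv_pCons del: mult_pCons_left)
    have p'': "pderiv (pderiv p) = pderiv q + (pderiv q + [:- a, 1:] * pderiv (pderiv q))"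
      by (simp add: p' pderiv_add pderiv_mult pderiv_pCons del: mult_pCons_left)
    show ?thesis
      unfolding p'' unfolding p' unfolding p by (simp add: power2_eq_square algebra_simps)
  qed
  finally show ?case by simp
qed

section \<open>Evaluation by coefficient lists\<close>

lemma Poly_map_upt: "Poly (map f [0..<n]) = (\<Sum>j<n. monom (f j) j)"
proof (rule poly_eqI)
  fix i
  show "coeff (Poly (map f [0..<n])) i = coeff (\<Sum>j<n. monom (f j) j) i"
    by (simp add: coeff_Poly_eq nth_default_def coeff_sum)
qed

lemma linear_power_Poly: "[:1, 1:] ^ n = Poly (map (\<lambda>k. int (n choose k)) [0..<Suc n])"
proof -
  have "[:1, 1:] = monom 1 1 + (1 :: int poly)" by (simp add: monom_Suc one_pCons)
  then have "([:1, 1:] :: int poly) ^ n = (monom 1 1 + 1) ^ n" by simp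
  also have "\<dots> = (\<Sum>k\<le>n. monom (int (n choose k)) k)"
    unfolding binomial_ring by (simp add: monom_power of_nat_poly smult_monom)
  finally show ?thesis by (simp only: Poly_map_upt lessThan_Suc_atMost)
qed

text \<open>The degrees j with 2 j < r are those below \<open>(r + 1) div 2\<close>;
  \<open>nth_default\<close> supplies the zeros past the end of the list.\<close>

lemma lower_part_Poly:
  "lower_part r (Poly xs) =
    Poly (map (\<lambda>j. nth_default 0 xs (r - j) - nth_default 0 xs j) [0..<(r + 1) div 2])"
proof -
  have "{j. 2 * j < r} = {..<(r + 1) div 2}" by auto
  then show ?thesis by (simp add: lower_part_def Poly_map_upt coeff_Poly_eq)
qed

lemmas circuit_sum_Poly = circuit_sum_def[folded Poly_map_upt]

section \<open>The parallel classes of sizes 15, 3, 3\<close>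

lemma upt_3: "[0..<3] = [0, 1, 2]"
  by code_simp

lemma upt_6: "[0..<6] = [0, 1, 2, 3, 4, 5]"
  by code_simp

lemma upt_9: "[0..<9] = [0, 1, 2, 3, 4, 5, 6, 7, 8]"
  by code_simp

lemma upt_15: "[0..<15] = [0, 1, 2, 3, 4, 5, 6, 7, 8, 9, 10, 11, 12, 13, 14]"
  by code_simp

lemma upt_18: "[0..<18] = [0, 1, 2, 3, 4, 5, 6, 7, 8, 9, 10, 11, 12, 13, 14, 15, 16, 17]"
  by code_simp

lemma upt_20: "[0..<20] = [0, 1, 2, 3, 4, 5, 6, 7, 8, 9, 10, 11, 12, 13, 14, 15, 16, 17, 18, 19]"
  by code_simp

lemmas choose_simps = binomial_fact' fact_numeral numeral_2_eq_2[symmetric]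

lemma circuit_sum_3: "circuit_sum 3 = [:0, 3, 2:]"
  by (simp add: circuit_sum_Poly upt_3 choose_simps)

lemma circuit_sum_15: "circuit_sum 15 = [:0, 105, 910, 4095, 12012, 25025, 38610, 45045, 40040,
    27027, 13650, 5005, 1260, 195, 14:]"
  by (simp add: circuit_sum_Poly upt_15 choose_simps)

lemma circuit_KL_6: "circuit_KL 6 = [:5, 9, 5:]"
proof -
  have "map (\<lambda>j. int j * int (6 choose Suc j)) [0..<6] = [0, 15, 40, 45, 24, 5]"
    by (simp add: upt_6 choose_simps)
  then have "circuit_KL 6 = lower_part 5 (Poly [0, 15, 40, 45, 24, 5])"
    by (simp add: circuit_KL_def circuit_sum_Poly)
  then show ?thesis unfolding lower_part_Poly by (simp add: nth_default_def upt_3)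
qed

lemma circuit_KL_18: "circuit_KL 18 = [:17, 135, 663, 2244, 5508, 9996, 13260, 11934, 4862:]"
proof -
  have "map (\<lambda>j. int j * int (18 choose Suc j)) [0..<18] = [0, 153, 1632, 9180, 34272, 92820,
      190944, 306306, 388960, 393822, 318240, 204204, 102816, 39780, 11424, 2295, 288, 17]"
    by (simp add: upt_18 choose_simps)
  then have "circuit_KL 18 = lower_part 17 (Poly [0, 153, 1632, 9180, 34272, 92820,
      190944, 306306, 388960, 393822, 318240, 204204, 102816, 39780, 11424, 2295, 288, 17])"
    by (simp add: circuit_KL_def circuit_sum_Poly)
  then show ?thesis unfolding lower_part_Poly by (simp add: nth_default_def upt_9)
qed

lemma linear_power_19: "[:1, 1:] ^ 19 = ([:1, 19, 171, 969, 3876, 11628, 27132, 50388, 75582, 92378,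
    92378, 75582, 50388, 27132, 11628, 3876, 969, 171, 19, 1:] :: int poly)"
  by (simp add: linear_power_Poly upt_20 choose_simps)

text \<open>The label of a class is the right end of its interval; only the partition
  matters.\<close>

definition block :: "nat \<Rightarrow> nat" where
  "block n = (if n < 15 then 15 else if n < 18 then 18 else 21)"

lemma block_image: "block ` {..<21} = {15, 18, 21}"
proof -
  have "block 0 \<in> block ` {..<21}" "block 15 \<in> block ` {..<21}" "block 18 \<in> block ` {..<21}"
    by (rule imageI, simp)+
  then have "{15, 18, 21} \<subseteq> block ` {..<21}" by (simp add: block_def)
  moreover have "block ` {..<21} \<subseteq> {15, 18, 21}" by (auto simp: block_def)
  ultimately show ?thesis by blast
qed

lemma card_block_fibres:
  "card {e \<in> {..<21}. block e = 15} = 15"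
  "card {e \<in> {..<21}. block e = 18} = 3"
  "card {e \<in> {..<21}. block e = 21} = 3"
proof -
  have "{e \<in> {..<21}. block e = 15} = {..<15}" "{e \<in> {..<21}. block e = 18} = {15..<18}"
      "{e \<in> {..<21}. block e = 21} = {18..<21}"
    by (auto simp: block_def)
  then show "card {e \<in> {..<21}. block e = 15} = 15" "card {e \<in> {..<21}. block e = 18} = 3"
      "card {e \<in> {..<21}. block e = 21} = 3"
    by simp_all
qed

lemma card_block_cofibres:
  "card {e \<in> {..<21}. block e \<noteq> 15} = 6"
  "card {e \<in> {..<21}. block e \<noteq> 18} = 18"
  "card {e \<in> {..<21}. block e \<noteq> 21} = 18"
proof -
  have "{e \<in> {..<21}. block e \<noteq> i} = {..<21} - {e \<in> {..<21}. block e = i}" for i by auto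
  then have "card {e \<in> {..<21}. block e \<noteq> i} = 21 - card {e \<in> {..<21}. block e = i}" for i
    by (simp only:) (subst card_Diff_subset; auto)
  from this[of 15] this[of 18] this[of 21]
  show "card {e \<in> {..<21}. block e \<noteq> 15} = 6" "card {e \<in> {..<21}. block e \<noteq> 18} = 18"
      "card {e \<in> {..<21}. block e \<noteq> 21} = 18"
    unfolding card_block_fibres by simp_all
qed

definition witness :: "nat set_system" where
  "witness = dual_system (class_rank block) {..<21}"

lemma class_rank_block_remove:
  "class_rank block ({..<21} - {e}) = 2" "class_rank block {..<21} = 2"
proof -
  \<comment> \<open>Two candidates from each of two classes, so that one of each survives the
    deletion of \<open>e\<close>.\<close>
  have "\<exists>f\<in>{15, 16}. f \<noteq> e" "\<exists>g\<in>{0, 1}. g \<noteq> e" by auto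
  then obtain f g where fg: "f \<in> {15, 16}" "f \<noteq> e" "g \<in> {0, 1}" "g \<noteq> e" by blast
  have "{block f, block g} \<subseteq> block ` ({..<21} - {e})" using fg by auto
  moreover have "card {block f, block g} = 2" using fg by (auto simp: block_def)
  ultimately have "2 \<le> card (block ` ({..<21} - {e}))"
    using card_mono[of "block ` ({..<21} - {e})" "{block f, block g}"] by simp
  then show "class_rank block ({..<21} - {e}) = 2" by (simp add: class_rank_def)
  show "class_rank block {..<21} = 2" by (simp add: class_rank_def block_image)
qed

lemma matroid_witness: "matroid witness"
  unfolding witness_def
  by (rule rank_function.matroid_dual_system[OF rank_function_class_rank]) simp

lemma loopless_witness: "loopless witness"
  unfolding witness_def
  by (simp add: rank_function.loopless_dual_system[OF rank_function_class_rank]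
      class_rank_block_remove)

lemma rk_witness: "rk witness = 19"
  unfolding witness_def rank_function.rk_dual_system[OF rank_function_class_rank finite_lessThan]
  by (simp add: class_rank_block_remove)

lemma KL_sum_proper_witness:
  "KL_sum_proper inverse_KL witness = Poly [0, 762, 9442, 60255, 255010, 787834, 1867026,
    3494396, 5258500, 6429540, 6448338, 5325008,
    3596562, 1963726, 854062, 289065, 73391, 13149, 1482, 79]"
proof -
  define L where "L = ([:1, 1:] :: int poly)"
  \<comment> \<open>99 = 210 - 105 - 3 - 3: all pairs minus those inside a class.\<close>
  have "card (split_pairs block {..<21}) = 99"
    using card_split_pairs[of "{..<21}" block]
    by (simp add: block_image card_block_fibres choose_simps del: lessThan_iff)
  then have "(\<Sum>Y\<in>Pow {..<21}. monom (signed_indep_count (class_rank block) Y) (card Y)) =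
      L ^ 21 + 21 * (monom (- 1) 1 * L ^ 20) + 99 * (monom 1 2 * L ^ 19)"
    unfolding sum_signed_indep_count[OF finite_lessThan] L_def
    using sum_indep_class_rank[of "{..<21}" "\<lambda>k. monom ((- 1 :: int) ^ k) k * [:1, 1:] ^ (21 - k)" block]
    by simp
  \<comment> \<open>Only the power 19 is expanded into coefficients; the higher powers reuse
    it.\<close>
  moreover have "L ^ 20 = L * L ^ 19" "L ^ 21 = L * (L * L ^ 19)"
    by (simp_all flip: power_Suc)
  ultimately have "monom 1 2 * KL_sum_proper inverse_KL witness =
      L * (L * L ^ 19) + 21 * (monom (- 1) 1 * (L * L ^ 19)) + 99 * (monom 1 2 * L ^ 19) - 1 +
      (circuit_sum 15 * (monom 1 1 + monom 1 2 * circuit_KL 6) +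
       (circuit_sum 3 * (monom 1 1 + monom 1 2 * circuit_KL 18) +
        circuit_sum 3 * (monom 1 1 + monom 1 2 * circuit_KL 18)))"
    unfolding witness_def
    by (subst KL_sum_proper_class_rank)
      (auto simp add: block_image card_block_cofibres card_block_fibres simp del: lessThan_iff)
  moreover have monom: "monom 1 1 = ([:0, 1:] :: int poly)" "monom (- 1) 1 = ([:0, - 1:] :: int poly)"
      "monom 1 2 = ([:0, 0, 1:] :: int poly)"
    by (simp_all add: monom_Suc monom_0 numeral_2_eq_2)
  ultimately have "monom 1 2 * KL_sum_proper inverse_KL witness = monom 1 2 *
      Poly [0, 762, 9442, 60255, 255010, 787834, 1867026,
    3494396, 5258500, 6429540, 6448338, 5325008,
    3596562, 1963726, 854062, 289065, 73391, 13149, 1482, 79]"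
    unfolding L_def linear_power_19 circuit_sum_15 circuit_sum_3 circuit_KL_6 circuit_KL_18
    by (simp add: monom numeral_poly one_pCons)
  moreover have "monom (1 :: int) 2 \<noteq> 0" by (simp add: monom_eq_0_iff)
  ultimately show ?thesis by (metis mult_left_cancel)
qed

text \<open>Differences of coefficients j and 19 - j of the proper sum. The constant term 79 = 1 -
  21 + 99 is the signed count of independent sets of the whole rank two matroid.\<close>

lemma inverse_KL_witness:
  "inverse_KL witness = Poly [79, 720, 3707, 13136, 34055, 66228, 96700, 102166, 66508, 18798]"
proof -
  have "inverse_KL witness = lower_part 19 (KL_sum_proper inverse_KL witness)"
    using inverse_KL_rk_pos[OF matroid_witness loopless_witness] by (simp add: rk_witness)
  moreover have "[0..<10] = [0, 1, 2, 3, 4, 5, 6, 7, 8, 9]" by code_simp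
  ultimately show ?thesis
    unfolding KL_sum_proper_witness lower_part_Poly by (simp add: nth_default_def)
qed

lemma normalization_witness:
  "normalization (inverse_KL witness) = Poly [79, 6480, 133452, 1103424, 4290930, 8344728, 8122800,
    3677976, 598572, 18798]"
proof -
  have eq: "normalization p = Poly (map (\<lambda>j. int (9 choose j) * coeff p j) [0..<10])"
    if "degree p = 9" for p
  proof -
    have "{..9} = {..<10 :: nat}" by auto
    then show ?thesis unfolding normalization_def Poly_map_upt that by simp
  qed
  have "[0..<10] = [0, 1, 2, 3, 4, 5, 6, 7, 8, 9]" by code_simp
  moreover have "degree (inverse_KL witness) = 9" unfolding inverse_KL_witness by simp
  ultimately show ?thesis
    unfolding eq[OF \<open>degree (inverse_KL witness) = 9\<close>]
    unfolding inverse_KL_witness coeff_Poly_eq by (simp add: choose_simps nth_default_def)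
qed

theorem theorem1p5:
  shows "\<exists>M :: nat set_system.
    matroid M \<and> loopless M \<and> rk M = 19 \<and> card (ground M) = 21 \<and>
    \<not> real_rooted (map_poly real_of_int (normalization (inverse_KL M)))"
proof (intro exI conjI)
  show "matroid witness" "loopless witness" "rk witness = 19"
    by (fact matroid_witness loopless_witness rk_witness)+
  show "card (ground witness) = 21" by (simp add: witness_def)
  show "\<not> real_rooted (map_poly real_of_int (normalization (inverse_KL witness)))"
  proof
    assume "real_rooted (map_poly real_of_int (normalization (inverse_KL witness)))"
    \<comment> \<open>At -1 the polynomial and its first two derivatives are -5573, -594 and
      -381456. The product of the outer two exceeds 2 * 10^9, whereas 594^2 = 352836.\<close>
    from real_rooted_imp_laguerre[OF this, of "- 1"] show False
      unfolding normalization_witness by (simp add: map_poly_pCons pderiv_pCons)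
  qed
qed

end
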